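(* Let $r\ge 2$, $t\ge r$, and let $\mathcal{H}$ be an $r$-graph which is sharply $t$-critical. Then the family $\mathrm{Forb}(\mathcal{H})$ is $\mathfrak{B}(\mathcal{K}_t^{(r)})$-vertex locally stable.
   Context: $r$-graph = $r$-uniform hypergraph; $\mathrm{Forb}(\mathcal{H})$ is the family of all $r$-graphs containing no (not necessarily induced) copy of $\mathcal{H}$. $\mathcal{K}^{(r)}_t$ is the complete $r$-graph on $t$ vertices. For a vertex $v$, its link is $L_{\mathcal{H}}(v)=\{I : |I|=r-1,\ I\cup\{v\}\in\mathcal{H}\}$, an $(r-1)$-graph. $\mathcal{G}$ is obtained from $\mathcal{F}$ by cloning a vertex $v$ to a set $W$ if $\mathcal{F}\subseteq\mathcal{G}$, $V(\mathcal{G})\setminus V(\mathcal{F})=W\setminus\{v\}$ and $L_{\mathcal{G}}(w)=L_{\mathcal{F}}(v)$ for all $w\in W$; a blowup of $\mathcal{F}$ is any $r$-graph isomorphic to one obtained from $\mathcal{F}$ by repeatedly cloning and deleting vertices; $\mathfrak{B}(\mathcal{F})$ is the set of blowups of $\mathcal{F}$. For a family $\mathfrak{H}$, $m(\mathfrak{H},n)$ is the maximum number of edges of a member of $\mathfrak{H}$ with $n$ vertices, and $d_{\mathfrak{H}}(\mathcal{F})=\min\{|\mathcal{F}\triangle\mathcal{F}'| : \mathcal{F}'\in\mathfrak{H},\ \mathrm{v}(\mathcal{F}')=\mathrm{v}(\mathcal{F})\}$ (minimum over members on the same vertex set, i.e. up to relabelling). A family $\mathfrak{F}$ is $\mathfrak{H}$-vertex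 locally stable if there exist $\varepsilon,\alpha>0$ and $n_0$ such that every $\mathcal{F}\in\mathfrak{F}$ with $\mathrm{v}(\mathcal{F})=n\ge n_0$, $d_{\mathfrak{H}}(\mathcal{F})\le\varepsilon n^r$ and $|L_{\mathcal{F}}(v)|\ge r(1-\varepsilon)m(\mathfrak{H},n)/n$ for every vertex $v$ satisfies $|\mathcal{F}|\le m(\mathfrak{H},n)-\alpha d_{\mathfrak{H}}(\mathcal{F})$. An $r$-graph is strongly $t$-colorable if its vertices can be colored with $t$ colors so that no edge contains two vertices of the same color. $\mathcal{H}$ is $t$-critical if it is not strongly $t$-colorable but $\mathcal{H}\setminus F$ is strongly $t$-colorable for some edge $F$ (a critical edge). A pair $(\mathcal{H},F)$ is freely $t$-critical if $F\in\mathcal{H}$ is critical and $r-2$ vertices of $F$ (called free) are contained in no other edge of $\mathcal{H}$; the remaining two vertices of $F$ are called critical. A triple $(\mathcal{H},F,v)$ with $v\in F\in\mathcal{H}$ is a $t$-spike if (i) $(\mathcal{H},F)$ is freely $t$-critical and $v$ is critical in $(\mathcal{H},F)$; (ii) $L_{\mathcal{H}}(v)$ is a matching (pairwise disjoint sets); (iii) for every $(r-1)$-graph $\mathcal{S}\subseteq[t]^{(r-1)}$ with $|\mathcal{S}|\ge\binom{t-1}{r-1}$ not isomorphic to $\mathcal{K}^{(r-1)}_{t-1}$ there is $\varphi:V(\mathcal{H})\to[t]$ such that (iii-a) $|\varphi(F')|=r$ for every edge $F'$ of $\mathcal{H}$ not containing $v$, and (iii-b) $|\varphi(I)|=r-1$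 and $\varphi(I)\in\mathcal{S}$ for every $I\in L_{\mathcal{H}}(v)$. $\mathcal{H}$ is sharply $t$-critical if there exist $v\in F\in\mathcal{H}$ with $(\mathcal{H},F,v)$ a $t$-spike. *)

theory Defs
  imports Complex_Main "HOL-Library.Ramsey"
begin

text \<open>
  A hypergraph is a pair (vertex set, edge set); isolated vertices are allowed and count as vertices.
  The expression \<open>nsets A k\<close> is the set of all \<open>k\<close>-element subsets of \<open>A\<close>.
\<close>

type_synonym 'a hgraph = "'a set \<times> 'a set set"

abbreviation verts :: "'a hgraph \<Rightarrow> 'a set" where "verts \<equiv> fst"
abbreviation edges :: "'a hgraph \<Rightarrow> 'a set set" where "edges \<equiv> snd"

definition rgraph :: "nat \<Rightarrow> 'a hgraph \<Rightarrow> bool" where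
  "rgraph r G \<longleftrightarrow> finite (verts G) \<and> edges G \<subseteq> nsets (verts G) r"

definition complete_hgraph :: "nat \<Rightarrow> nat \<Rightarrow> nat hgraph" where
  "complete_hgraph r t = ({1..t}, nsets {1..t} r)"

definition link :: "nat \<Rightarrow> 'a hgraph \<Rightarrow> 'a \<Rightarrow> 'a set set" where
  "link r G v = {I. card I = r - 1 \<and> insert v I \<in> edges G}"

definition isomorphic :: "'a hgraph \<Rightarrow> 'b hgraph \<Rightarrow> bool" where
  "isomorphic G G' \<longleftrightarrow>
    (\<exists>f. bij_betw f (verts G) (verts G') \<and> edges G' = (\<lambda>e. f ` e) ` edges G)"

definition contains_copy :: "'b hgraph \<Rightarrow> 'a hgraph \<Rightarrow> bool" where
  "contains_copy G H \<longleftrightarrow>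
    (\<exists>f. inj_on f (verts H) \<and> f ` verts H \<subseteq> verts G \<and> (\<forall>e\<in>edges H. f ` e \<in> edges G))"

text \<open>
  Families of hypergraphs are families on vertex sets contained in \<open>nat\<close>; every finite
  hypergraph has an isomorphic copy there.
\<close>

definition Forb :: "nat \<Rightarrow> 'a hgraph \<Rightarrow> nat hgraph set" where
  "Forb r H = {G. rgraph r G \<and> \<not> contains_copy G H}"

text \<open>
  In cloning, \<open>F\<close> has to be the subgraph of \<open>G\<close> induced by \<open>verts F\<close>: the link condition alone
  does not restrict the edges of \<open>G\<close> disjoint from \<open>W\<close>, and with \<open>edges F \<subseteq> edges G\<close>
  only, a cloning step could add arbitrary new edges among the old vertices other than \<open>v\<close>.
\<close>

definition cloning :: "nat \<Rightarrow> 'a hgraph \<Rightarrow> 'a \<Rightarrow> 'a set \<Rightarrow> 'a hgraph \<Rightarrow> bool" where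
  "cloning r F v W G \<longleftrightarrow>
    rgraph r G \<and> v \<in> verts F \<and> v \<in> W \<and>
    verts F \<subseteq> verts G \<and> edges F = {e \<in> edges G. e \<subseteq> verts F} \<and>
    verts G - verts F = W - {v} \<and>
    (\<forall>w\<in>W. link r G w = link r F v)"

definition delete_vertex :: "'a hgraph \<Rightarrow> 'a \<Rightarrow> 'a hgraph" where
  "delete_vertex G x = (verts G - {x}, {e \<in> edges G. x \<notin> e})"

inductive clone_delete :: "nat \<Rightarrow> 'a hgraph \<Rightarrow> 'a hgraph \<Rightarrow> bool" for r F where
  base: "clone_delete r F F"
| clone: "clone_delete r F G \<Longrightarrow> cloning r G v W G' \<Longrightarrow> clone_delete r F G'"
| delete: "clone_delete r F G \<Longrightarrow> clone_delete r F (delete_vertex G x)"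

definition blowups :: "nat \<Rightarrow> nat hgraph \<Rightarrow> nat hgraph set" where
  "blowups r F = {G. \<exists>G'. clone_delete r F G' \<and> isomorphic G' G}"

definition max_edges :: "nat hgraph set \<Rightarrow> nat \<Rightarrow> nat" where
  "max_edges \<HH> n = Max {card (edges G) | G. G \<in> \<HH> \<and> card (verts G) = n}"

text \<open>
  For families closed under isomorphism, taking the minimum over members with the same vertex set
  is the same as taking it over all placements on that vertex set of members with equally many
  vertices.
\<close>

definition edit_distance :: "nat hgraph set \<Rightarrow> nat hgraph \<Rightarrow> nat" where
  "edit_distance \<HH> F =
    Min {card (sym_diff (edges F) (edges F')) | F'. F' \<in> \<HH> \<and> verts F' = verts F}"

definition vertex_locally_stable :: "nat \<Rightarrow> nat hgraph set \<Rightarrow> nat hgraph set \<Rightarrow> bool" where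
  "vertex_locally_stable r \<FF> \<HH> \<longleftrightarrow>
    (\<exists>\<epsilon>>0. \<exists>\<alpha>>0. \<exists>n0::nat. \<forall>F\<in>\<FF>. \<forall>n. card (verts F) = n \<longrightarrow> n \<ge> n0 \<longrightarrow>
      real (edit_distance \<HH> F) \<le> \<epsilon> * real n ^ r \<longrightarrow>
      (\<forall>v\<in>verts F. real (card (link r F v)) \<ge>
         real r * (1 - \<epsilon>) * real (max_edges \<HH> n) / real n) \<longrightarrow>
      real (card (edges F)) \<le> real (max_edges \<HH> n) - \<alpha> * real (edit_distance \<HH> F))"

definition strongly_colorable :: "nat \<Rightarrow> 'a hgraph \<Rightarrow> bool" where
  "strongly_colorable t H \<longleftrightarrow>
    (\<exists>c \<in> verts H \<rightarrow> {1..t}. \<forall>e\<in>edges H. inj_on c e)"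

definition critical_edge :: "nat \<Rightarrow> 'a hgraph \<Rightarrow> 'a set \<Rightarrow> bool" where
  "critical_edge t H F \<longleftrightarrow>
    F \<in> edges H \<and> \<not> strongly_colorable t H \<and> strongly_colorable t (verts H, edges H - {F})"

definition free_vertices :: "'a hgraph \<Rightarrow> 'a set \<Rightarrow> 'a set" where
  "free_vertices H F = {x \<in> F. \<forall>F'\<in>edges H. x \<in> F' \<longrightarrow> F' = F}"

definition critical_vertices :: "'a hgraph \<Rightarrow> 'a set \<Rightarrow> 'a set" where
  "critical_vertices H F = F - free_vertices H F"

text \<open>
  Requiring exactly \<open>r - 2\<close> free vertices loses nothing compared with at least \<open>r - 2\<close>
  when \<open>t \<ge> r\<close>: if \<open>r - 1\<close> vertices of \<open>F\<close> were in no other edge, a coloring of \<open>H\<close> without \<open>F\<close>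
  could be changed on them to give \<open>F\<close> distinct colors, so \<open>F\<close> would not be critical.
\<close>

definition freely_critical :: "nat \<Rightarrow> nat \<Rightarrow> 'a hgraph \<Rightarrow> 'a set \<Rightarrow> bool" where
  "freely_critical r t H F \<longleftrightarrow> critical_edge t H F \<and> card (free_vertices H F) = r - 2"

text \<open>
  In the last condition, \<open>S\<close> is an edge set without a prescribed vertex set, so for the
  comparison with the complete \<open>(r-1)\<close>-graph on \<open>t - 1\<close> vertices its vertex set is \<open>\<Union>S\<close>:
  excluded are exactly the sets \<open>nsets ({1..t} - {i}) (r - 1)\<close>.
\<close>

definition spike :: "nat \<Rightarrow> nat \<Rightarrow> 'a hgraph \<Rightarrow> 'a set \<Rightarrow> 'a \<Rightarrow> bool" where
  "spike r t H F v \<longleftrightarrow>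
    F \<in> edges H \<and> v \<in> F \<and>
    freely_critical r t H F \<and> v \<in> critical_vertices H F \<and>
    pairwise disjnt (link r H v) \<and>
    (\<forall>S. S \<subseteq> nsets {1..t} (r - 1) \<and> card S \<ge> (t - 1) choose (r - 1) \<and>
         \<not> isomorphic (\<Union>S, S) (complete_hgraph (r - 1) (t - 1)) \<longrightarrow>
       (\<exists>\<phi> \<in> verts H \<rightarrow> {1..t}.
          (\<forall>F'\<in>edges H. v \<notin> F' \<longrightarrow> card (\<phi> ` F') = r) \<and>
          (\<forall>I\<in>link r H v. card (\<phi> ` I) = r - 1 \<and> \<phi> ` I \<in> S)))"

definition sharply_critical :: "nat \<Rightarrow> nat \<Rightarrow> 'a hgraph \<Rightarrow> bool" where
  "sharply_critical r t H \<longleftrightarrow> (\<exists>F v. spike r t H F v)"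

end

(*
  The blowups of K_t^(r) are the complete t-partite r-graphs. Let G be H-free, close to such an
  r-graph and with large minimum degree, and let c be a coloring of its vertices whose complete
  t-partite r-graph B is nearest to G. Then G is contained in B, so that |G| = |B| - |B - G| <= m
  - d: the constant alpha can be taken to be 1.

  Since |B| is nearly maximal, all parts have size close to n/t. Call a vertex good if it lies in
  few edges of B - G; all but a small proportion of the vertices are good. If an edge of G
  contained two good vertices of the same color, then H could be embedded with its critical edge F
  on that edge and almost any choice of the other vertices in the right parts, because H - F is
  t-colorable with the two critical vertices of F of the same color. Hence almost all link sets of
  a vertex x meet each part at most once. The set S of color sets that occur often in the link of
  x has at least C(t-1,r-1) elements because of the degree of x, and so by the spike condition it
  consists of the (r-1)-subsets of [t] - {i} for some i, as otherwise H embeds with v on x. Then x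
  fits color i almost perfectly, so by optimality of c it also fits its own color; that is, every
  x is good, and the embedding of the critical edge applies to all pairs of vertices.
*)

theory Submission
  imports Defs
begin

section \<open>Blowups of complete hypergraphs\<close>

text \<open>The obstacle is a small set of bad vertices: missing edges are bounded only in total, so
  a vertex may lack many edges of B and owe its large degree to edges outside B. The embedding
  around a critical edge needs two good vertices. The spike embedding works at any vertex x: edges
  of H through v are placed directly on edges of G at x, so only the other edges of H can fail, and
  for them the total bound suffices. Since the link of v is a matching, its members can be placed
  independently.

  Degrees are measured in units of n^(r-1). In a balanced coloring each color set T is realized by
  about q = (1/t)^(r-1) such units, and the average degree of an extremal blowup is about C(t-1,r-1)
  * q. Hence fewer than C(t-1,r-1) frequent color sets cannot account for the degree of x.

  The constants are chosen in the order g, \<open>\<delta>\<^sub>1\<close>, \<tau>,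
  \<open>\<delta>\<^sub>2\<close>, \<beta>, \<epsilon>. The bound \<open>\<delta>\<^sub>1\<close>
  for goodness precedes the frequency threshold \<tau>, because the defect finally obtained at each
  vertex is a fixed multiple of \<tau> and has to fall below \<open>\<delta>\<^sub>1\<close>. The
  spike embedding has choices of density \<tau> instead of g, hence its own tolerance
  \<open>\<delta>\<^sub>2\<close>.\<close>

definition rainbow :: "nat \<Rightarrow> 'a set \<Rightarrow> ('a \<Rightarrow> 'b) \<Rightarrow> 'a set set" where
  "rainbow k V c = {e \<in> nsets V k. inj_on c e}"

text \<open>Here \<open>rainbow r V c\<close> is the edge set of the complete multipartite
  \<open>r\<close>-graph whose parts are the fibres of \<open>c\<close>. The coloring need not be
  onto: empty parts arise by deleting vertices.\<close>

definition multipartite :: "nat \<Rightarrow> nat \<Rightarrow> 'a hgraph \<Rightarrow> bool" where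
  "multipartite r t G \<longleftrightarrow>
    finite (verts G) \<and> (\<exists>c \<in> verts G \<rightarrow> {1..t}. edges G = rainbow r (verts G) c)"

lemma rainbow_cong: "(\<And>x. x \<in> V \<Longrightarrow> c x = c' x) \<Longrightarrow> rainbow k V c = rainbow k V c'"
  unfolding rainbow_def nsets_def inj_on_def by (simp add: subset_iff cong: conj_cong)

lemma multipartite_complete: "multipartite r t (complete_hgraph r t)"
proof -
  have "nsets {1..t} r = rainbow r {1..t} id"
    by (simp add: rainbow_def)
  then show ?thesis
    unfolding multipartite_def complete_hgraph_def
    by (auto intro!: bexI[of _ id])
qed

lemma multipartite_isomorphic:
  assumes "multipartite r t G" and "isomorphic G G'"
  shows "multipartite r t G'"
proof -
  obtain c where fin: "finite (verts G)" and c: "c \<in> verts G \<rightarrow> {1..t}"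
    and E: "edges G = rainbow r (verts G) c"
    using assms(1) unfolding multipartite_def by auto
  obtain f where f: "bij_betw f (verts G) (verts G')" and E': "edges G' = (\<lambda>e. f ` e) ` edges G"
    using assms(2) unfolding isomorphic_def by auto
  define g where "g = inv_into (verts G) f"
  have g: "bij_betw g (verts G') (verts G)"
    unfolding g_def by (rule bij_betw_inv_into[OF f])
  have gf: "g (f x) = x" if "x \<in> verts G" for x
    unfolding g_def using f that by (simp add: bij_betw_def)
  have fg: "f (g x) = x" if "x \<in> verts G'" for x
    unfolding g_def using f that by (simp add: bij_betw_def f_inv_into_f)
  have finj: "inj_on f (verts G)" and fim: "f ` verts G = verts G'"
    using f by (auto simp: bij_betw_def)
  have ginj: "inj_on g (verts G')" and gim: "g ` verts G' = verts G"
    using g by (auto simp: bij_betw_def)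
  have "edges G' = rainbow r (verts G') (c \<circ> g)"
  proof (rule set_eqI)
    fix e
    show "e \<in> edges G' \<longleftrightarrow> e \<in> rainbow r (verts G') (c \<circ> g)"
    proof
      assume "e \<in> edges G'"
      then obtain a where a: "a \<in> rainbow r (verts G) c" "e = f ` a" using E E' by auto
      have av: "a \<subseteq> verts G" "finite a" "card a = r" "inj_on c a"
        using a(1) by (auto simp: rainbow_def nsets_def)
      have "card e = r" using av finj a(2) by (metis card_image inj_on_subset)
      moreover have "g ` e = a" using av gf a(2) by (force simp: image_image)
      moreover have "e \<subseteq> verts G'" using a(2) av fim by auto
      moreover have "inj_on g e" using ginj \<open>e \<subseteq> verts G'\<close> by (metis inj_on_subset)
      ultimately show "e \<in> rainbow r (verts G') (c \<circ> g)"
        using av a(2) by (auto simp: rainbow_def nsets_def intro: comp_inj_on)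
    next
      assume "e \<in> rainbow r (verts G') (c \<circ> g)"
      then have e: "e \<subseteq> verts G'" "finite e" "card e = r" "inj_on (c \<circ> g) e"
        by (auto simp: rainbow_def nsets_def)
      have "f ` g ` e = e" using e fg by (force simp: image_image)
      moreover have "g ` e \<in> rainbow r (verts G) c"
        using e gim card_image[OF inj_on_subset[OF ginj e(1)]]
        by (auto simp: rainbow_def nsets_def inj_on_imageI)
      ultimately show "e \<in> edges G'" using E E' by (metis image_eqI)
    qed
  qed
  moreover have "c \<circ> g \<in> verts G' \<rightarrow> {1..t}"
    by (intro Pi_I, unfold comp_apply) (use c gim in blast)
  moreover have "finite (verts G')" using fin fim finite_imageI by metis
  ultimately show ?thesis unfolding multipartite_def by blast
qed

text \<open>The definition of \<open>link\<close> does not demand \<open>w \<notin> I\<close>. If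
  \<open>w\<close> were in \<open>I\<close>, then \<open>insert w I = I\<close> would be an edge
  with \<open>r - 1\<close> instead of \<open>r\<close> vertices.\<close>

lemma link_rgraph:
  assumes "rgraph r G" "r \<ge> 2"
  shows "I \<in> link r G w \<longleftrightarrow> w \<notin> I \<and> insert w I \<in> edges G"
proof
  assume "I \<in> link r G w"
  then have I: "card I = r - 1" "insert w I \<in> edges G" by (auto simp: link_def)
  then have "card (insert w I) = r" using assms by (auto simp: rgraph_def nsets_def)
  then have "w \<notin> I" using I assms(2) by (metis diff_less insert_absorb less_irrefl zero_less_one order.strict_trans2 pos2)
  then show "w \<notin> I \<and> insert w I \<in> edges G" using I by simp
next
  assume a: "w \<notin> I \<and> insert w I \<in> edges G"
  then have "card (insert w I) = r" "finite (insert w I)" using assms by (auto simp: rgraph_def nsets_def)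
  then show "I \<in> link r G w" using a by (auto simp: link_def)
qed

text \<open>An edge that leaves \<open>verts F\<close> contains a clone \<open>w\<close>, and
  exchanging \<open>w\<close> for \<open>v\<close> preserves colors, so the equality of links
  transfers both membership and rainbowness. A rainbow set contains at most one vertex of
  \<open>W\<close>, as all of them share the color of \<open>v\<close>; hence the exchange really
  ends inside \<open>verts F\<close>.\<close>

lemma cloning_edges:
  assumes cl: "cloning r F v W G" and r: "r \<ge> 2"
    and c: "edges F = rainbow r (verts F) c"
    and cW: "\<And>x. x \<in> verts F \<Longrightarrow> c' x = c x" "\<And>w. w \<in> W \<Longrightarrow> c' w = c v"
  shows "edges G = rainbow r (verts G) c'"
proof -
  have G: "rgraph r G" and v: "v \<in> verts F" "v \<in> W" and sub: "verts F \<subseteq> verts G"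
    and ind: "edges F = {e \<in> edges G. e \<subseteq> verts F}"
    and W: "verts G - verts F = W - {v}"
    and L: "\<And>w. w \<in> W \<Longrightarrow> link r G w = link r F v"
    using cl by (auto simp: cloning_def)
  have F: "rgraph r F" using G sub ind by (auto simp: rgraph_def nsets_def intro: finite_subset)
  show ?thesis
  proof (rule set_eqI)
    fix e
    show "e \<in> edges G \<longleftrightarrow> e \<in> rainbow r (verts G) c'"
    proof (cases "e \<subseteq> verts F")
      case True
      have "inj_on c e \<longleftrightarrow> inj_on c' e" using True cW(1) by (intro inj_on_cong) auto
      then have "e \<in> edges F \<longleftrightarrow> e \<in> rainbow r (verts G) c'"
        unfolding c using True sub by (auto simp: rainbow_def nsets_def)
      then show ?thesis using ind True by auto
    next
      case out: False
      show ?thesis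
      proof
        assume e: "e \<in> edges G"
        then have eG: "e \<subseteq> verts G" "finite e" "card e = r" using G by (auto simp: rgraph_def nsets_def)
        obtain w where w: "w \<in> e" "w \<in> W" "w \<noteq> v" using out eG W by blast
        then have "e - {w} \<in> link r G w"
          using e link_rgraph[OF G r] by (simp add: insert_absorb)
        then have "e - {w} \<in> link r F v" using L w by simp
        then have I: "v \<notin> e - {w}" "insert v (e - {w}) \<in> edges F"
          using link_rgraph[OF F r] by auto
        then have "inj_on c (insert v (e - {w}))" and *: "insert v (e - {w}) \<subseteq> verts F"
          using c by (auto simp: rainbow_def nsets_def)
        then have "inj_on c' (insert v (e - {w}))"
          using inj_on_cong[of "insert v (e - {w})" c c'] cW(1) subsetD[OF *] by metis
        moreover have "c' v = c' w" using cW(2) v w by auto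
        ultimately have "inj_on c' (insert w (e - {w}))"
          using I(1) unfolding inj_on_insert by (metis Diff_insert_absorb Diff_idemp)
        then have "inj_on c' e" using w(1) by (simp only: insert_Diff)
        then show "e \<in> rainbow r (verts G) c'" using eG by (auto simp: rainbow_def nsets_def)
      next
        assume "e \<in> rainbow r (verts G) c'"
        then have eG: "e \<subseteq> verts G" "finite e" "card e = r" "inj_on c' e" by (auto simp: rainbow_def nsets_def)
        obtain w where w: "w \<in> e" "w \<in> W" "w \<notin> verts F" "w \<noteq> v" using out eG W by blast
        have no: "x \<notin> W" if "x \<in> e" "x \<noteq> w" for x
          using that w cW(2)[of x] cW(2)[of w] eG(4) by (auto simp: inj_on_def)
        have eF: "e - {w} \<subseteq> verts F" using no eG(1) W by blast
        have vn: "v \<notin> e - {w}" using no v w by auto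
        have "c' v = c' w" using cW(2) v w by auto
        then have "inj_on c' (insert v (e - {w}))"
          using eG(4) vn w by (auto simp: inj_on_def)
        then have "inj_on c (insert v (e - {w}))"
          using inj_on_cong[of "insert v (e - {w})" c c'] cW(1) v(1) subsetD[OF eF]
          by (metis insertE)
        moreover have "card (insert v (e - {w})) = r"
          using vn w eG r by (simp add: card_Diff_singleton)
        ultimately have "insert v (e - {w}) \<in> edges F"
          unfolding c using eF v eG(2) by (auto simp: rainbow_def nsets_def)
        then have "e - {w} \<in> link r F v" using vn link_rgraph[OF F r] by auto
        then have "e - {w} \<in> link r G w" using L w by simp
        then have "insert w (e - {w}) \<in> edges G" using link_rgraph[OF G r] by blast
        then show "e \<in> edges G" using w by (simp add: insert_absorb)
      qed
    qed
  qed
qed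

lemma multipartite_clone_delete:
  assumes "clone_delete r F G" and r: "r \<ge> 2" and "multipartite r t F"
  shows "multipartite r t G"
  using assms(1)
proof (induction rule: clone_delete.induct)
  case base
  show ?case by fact
next
  case (clone G v W G')
  obtain c where fin: "finite (verts G)" and c: "c \<in> verts G \<rightarrow> {1..t}"
    and E: "edges G = rainbow r (verts G) c"
    using clone.IH unfolding multipartite_def by auto
  define c' where "c' x = (if x \<in> verts G then c x else c v)" for x
  have W: "verts G' - verts G = W - {v}" "v \<in> verts G" "v \<in> W" "finite (verts G')"
    "verts G \<subseteq> verts G'"
    using clone.hyps(2) by (auto simp: cloning_def rgraph_def)
  obtain W' where W': "W' = W - verts G \<union> {v}" by blast
  have cl': "cloning r G v W' G'" using clone.hyps(2) W'
    by (auto simp: cloning_def)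
  have "edges G' = rainbow r (verts G') c'"
    by (rule cloning_edges[OF cl' r E]) (use W W' in \<open>auto simp: c'_def\<close>)
  moreover have "c' \<in> verts G' \<rightarrow> {1..t}"
  proof
    fix x assume "x \<in> verts G'"
    show "c' x \<in> {1..t}"
      using Pi_mem[OF c W(2)] Pi_mem[OF c, of x] unfolding c'_def by presburger
  qed
  ultimately show ?case using W unfolding multipartite_def by blast
next
  case (delete G x)
  obtain c where fin: "finite (verts G)" and c: "c \<in> verts G \<rightarrow> {1..t}"
    and E: "edges G = rainbow r (verts G) c"
    using delete.IH unfolding multipartite_def by auto
  have "edges (delete_vertex G x) = rainbow r (verts (delete_vertex G x)) c"
    unfolding delete_vertex_def E by (auto simp: rainbow_def nsets_def)
  then show ?case using fin c unfolding multipartite_def delete_vertex_def by auto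
qed

text \<open>Adding a vertex to a nonempty part is a cloning step. Two vertices of one color never
  share a rainbow edge, so \<open>v\<close> and \<open>w\<close> have the same link, and it lies in
  the old vertex set.\<close>

lemma rainbow_cloning:
  assumes "finite V" "w \<notin> V" "v \<in> V" "c w = c v" "r \<ge> 2"
  shows "cloning r (V, rainbow r V c) v {v, w} (insert w V, rainbow r (insert w V) c)"
proof -
  have G: "rgraph r (insert w V, rainbow r (insert w V) c)"
    and F: "rgraph r (V, rainbow r V c)"
    using assms(1) by (auto simp: rgraph_def rainbow_def)
  have "link r (insert w V, rainbow r (insert w V) c) x = link r (V, rainbow r V c) v"
    if x: "x \<in> {v, w}" for x
  proof (rule set_eqI)
    fix I
    have *: "insert x I \<in> rainbow r (insert w V) c \<longleftrightarrow> insert v I \<in> rainbow r V c" if xI: "x \<notin> I" "v \<notin> I"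
    proof -
      have "card (insert x I) = card (insert v I)" if "finite I" using that xI by simp
      moreover have "inj_on c (insert x I) \<longleftrightarrow> inj_on c (insert v I)"
      proof -
        have "c x = c v" using x assms(4) by auto
        then show ?thesis by (simp add: inj_on_insert xI)
      qed
      moreover have "insert x I \<subseteq> insert w V \<longleftrightarrow> insert v I \<subseteq> V" if "inj_on c (insert x I)"
      proof -
        have "w \<notin> I" using xI x that assms(4) imageI[of w I c] by (auto simp: inj_on_insert)
        then show ?thesis using x assms by auto
      qed
      ultimately show ?thesis by (auto simp: rainbow_def nsets_def)
    qed
    have vw: "v \<noteq> w" using assms by auto
    show "I \<in> link r (insert w V, rainbow r (insert w V) c) x \<longleftrightarrow> I \<in> link r (V, rainbow r V c) v"
      unfolding link_rgraph[OF G assms(5)] link_rgraph[OF F assms(5)] snd_conv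
    proof
      assume a: "x \<notin> I \<and> insert x I \<in> rainbow r (insert w V) c"
      then have "inj_on c (insert x I)" by (auto simp: rainbow_def)
      then have "v \<notin> I" using a x assms(4) vw by (auto simp: inj_on_insert)
      then show "v \<notin> I \<and> insert v I \<in> rainbow r V c" using a * by blast
    next
      assume a: "v \<notin> I \<and> insert v I \<in> rainbow r V c"
      then have "I \<subseteq> V" by (auto simp: rainbow_def nsets_def)
      then have "x \<notin> I" using a x assms(2) by auto
      then show "x \<notin> I \<and> insert x I \<in> rainbow r (insert w V) c" using a * by blast
    qed
  qed
  then show ?thesis using G assms
    by (auto simp: cloning_def rainbow_def nsets_def)
qed

text \<open>The \<open>t\<close> original vertices stay until all of \<open>V\<close> has been
  cloned, so that every color has a vertex to clone; deleting them at the end leaves exactly the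
  prescribed part sizes, zero included.\<close>

lemma clone_delete_rainbow:
  assumes V: "finite V" "V \<inter> {1..t} = {}" and c: "c \<in> V \<rightarrow> {1..t}" and r: "r \<ge> 2"
  shows "clone_delete r (complete_hgraph r t) (V, rainbow r V c)"
proof -
  define d where "d x = (if x \<in> {1..t} then x else c x)" for x
  have clone: "clone_delete r (complete_hgraph r t) ({1..t} \<union> V, rainbow r ({1..t} \<union> V) d)"
    using V c
  proof (induction V rule: finite_induct)
    case empty
    have "rainbow r {1..t} d = nsets {1..t} r" by (auto simp: rainbow_def d_def nsets_def inj_on_def)
    then show ?case using clone_delete.base[of r "complete_hgraph r t"]
      by (simp add: complete_hgraph_def)
  next
    case (insert w V)
    then have IH: "clone_delete r (complete_hgraph r t) ({1..t} \<union> V, rainbow r ({1..t} \<union> V) d)"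
      by auto
    have cw: "c w \<in> {1..t}" using insert.prems by auto
    then have "d w = d (c w)" using insert.prems by (auto simp: d_def)
    with cw have "cloning r ({1..t} \<union> V, rainbow r ({1..t} \<union> V) d) (c w) {c w, w}
       (insert w ({1..t} \<union> V), rainbow r (insert w ({1..t} \<union> V)) d)"
      using insert.hyps insert.prems r
      by (intro rainbow_cloning) auto
    then show ?case using clone_delete.clone[OF IH] by simp
  qed
  have del: "clone_delete r (complete_hgraph r t) ({1..t} \<union> V - D, rainbow r ({1..t} \<union> V - D) d)"
    if "finite D" for D
    using that
  proof (induction D rule: finite_induct)
    case empty
    show ?case using clone by simp
  next
    case (insert x D)
    have "delete_vertex ({1..t} \<union> V - D, rainbow r ({1..t} \<union> V - D) d) x =
      ({1..t} \<union> V - insert x D, rainbow r ({1..t} \<union> V - insert x D) d)"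
      by (auto simp: delete_vertex_def rainbow_def nsets_def)
    then show ?case using clone_delete.delete[OF insert.IH, of x] by simp
  qed
  have "{1..t} \<union> V - {1..t} = V" using V by auto
  moreover have "rainbow r V d = rainbow r V c" using V by (intro rainbow_cong) (auto simp: d_def)
  ultimately show ?thesis using del[of "{1..t}"] by simp
qed

lemma blowups_complete_iff:
  assumes r: "r \<ge> 2"
  shows "G \<in> blowups r (complete_hgraph r t) \<longleftrightarrow> multipartite r t G"
proof
  assume "G \<in> blowups r (complete_hgraph r t)"
  then show "multipartite r t G"
    using multipartite_clone_delete[OF _ r multipartite_complete] multipartite_isomorphic
    unfolding blowups_def by blast
next
  assume G: "multipartite r t G"
  \<comment> \<open>The shift makes \<open>verts G\<close> disjoint from \<open>{1..t}\<close>, so that it can be added by cloning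
    before \<open>{1..t}\<close> is deleted.\<close>
  define f :: "nat \<Rightarrow> nat" where "f x = x + Suc t" for x
  have f: "inj_on f A" for A by (auto simp: f_def inj_on_def)
  define G' where "G' = (f ` verts G, (\<lambda>e. f ` e) ` edges G)"
  have "isomorphic G G'" unfolding isomorphic_def G'_def using f
    by (auto intro!: exI[of _ f] simp: bij_betw_def)
  then have "multipartite r t G'" by (rule multipartite_isomorphic[OF G])
  then obtain c where c: "finite (verts G')" "c \<in> verts G' \<rightarrow> {1..t}" "edges G' = rainbow r (verts G') c"
    by (auto simp: multipartite_def)
  have "clone_delete r (complete_hgraph r t) (verts G', rainbow r (verts G') c)"
    by (rule clone_delete_rainbow[OF c(1) _ c(2) r]) (auto simp: G'_def f_def)
  then have "clone_delete r (complete_hgraph r t) G'" using c by (metis prod.collapse)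
  moreover have "isomorphic G' G"
  proof -
    have inv: "inv_into (verts G) f (f x) = x" if "x \<in> verts G" for x using f that by simp
    have eV: "e \<subseteq> verts G" if "e \<in> edges G" for e
      using G that by (auto simp: multipartite_def rainbow_def nsets_def)
    have "bij_betw (inv_into (verts G) f) (verts G') (verts G)"
      unfolding G'_def fst_conv by (intro bij_betw_inv_into inj_on_imp_bij_betw f)
    moreover have "inv_into (verts G) f ` (f ` e) = e" if "e \<in> edges G" for e
      using eV[OF that] inv f by (metis inv_into_image_cancel)
    then have "(\<lambda>e. inv_into (verts G) f ` e) ` edges G' = edges G"
      unfolding G'_def by (force simp: image_iff)
    ultimately show ?thesis unfolding isomorphic_def by auto
  qed
  ultimately show "G \<in> blowups r (complete_hgraph r t)" unfolding blowups_def by blast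
qed

section \<open>Counting edges of complete multipartite hypergraphs\<close>

lemma finite_rainbow: "finite V \<Longrightarrow> finite (rainbow k V c)"
  unfolding rainbow_def by (simp add: finite_imp_finite_nsets)

lemma card_nsets_le: "finite A \<Longrightarrow> card (nsets A k) \<le> card A ^ k"
  by (cases "k \<le> card A") (simp_all add: card_nsets binomial_le_pow binomial_eq_0)

text \<open>A rainbow set with color set \<open>T\<close> is a transversal of the parts indexed by
  \<open>T\<close>, that is, the image of a unique choice function on \<open>T\<close>.\<close>

lemma card_rainbow_type:
  assumes V: "finite V" and T: "finite T" "card T = k"
  shows "card {e \<in> rainbow k V c. c ` e = T} = (\<Prod>i\<in>T. card {x \<in> V. c x = i})"
proof -
  let ?P = "PiE T (\<lambda>i. {x \<in> V. c x = i})"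
  have "bij_betw (\<lambda>f. f ` T) ?P {e \<in> rainbow k V c. c ` e = T}"
    unfolding bij_betw_def
  proof
    have cf: "c (f i) = i" if "f \<in> ?P" "i \<in> T" for f i
      using PiE_mem[OF that] by simp
    show "inj_on (\<lambda>f. f ` T) ?P"
    proof (rule inj_onI, rule PiE_ext)
      fix f g i assume fg: "f \<in> ?P" "g \<in> ?P" "f ` T = g ` T" and i: "i \<in> T"
      have "f i \<in> f ` T" using i by (rule imageI)
      then obtain j where j: "j \<in> T" "f i = g j" unfolding fg(3) by (elim imageE)
      then have "i = j" using cf[OF fg(1) i] cf[OF fg(2) j(1)] by simp
      then show "f i = g i" using j by simp
    qed
    show "(\<lambda>f. f ` T) ` ?P = {e \<in> rainbow k V c. c ` e = T}"
    proof
      show "(\<lambda>f. f ` T) ` ?P \<subseteq> {e \<in> rainbow k V c. c ` e = T}"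
      proof (rule image_subsetI)
        fix f assume f: "f \<in> ?P"
        have "inj_on f T" by (rule inj_on_inverseI[of _ c]) (use cf f in auto)
        moreover have "inj_on c (f ` T)" using cf[OF f] by (auto simp: inj_on_def)
        moreover have "f ` T \<subseteq> V" using PiE_mem[OF f] by blast
        moreover have "c ` f ` T = T" using cf[OF f] by (simp add: image_image)
        ultimately show "f ` T \<in> {e \<in> rainbow k V c. c ` e = T}"
          using T by (simp add: rainbow_def nsets_def card_image)
      qed
      show "{e \<in> rainbow k V c. c ` e = T} \<subseteq> (\<lambda>f. f ` T) ` ?P"
      proof
        fix e assume "e \<in> {e \<in> rainbow k V c. c ` e = T}"
        then have inj: "inj_on c e" and eV: "e \<subseteq> V" and ce: "c ` e = T"
          by (auto simp: rainbow_def nsets_def)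
        define g where "g = inv_into e c"
        have g: "g i \<in> e" "c (g i) = i" if "i \<in> T" for i
          using that unfolding g_def ce[symmetric] by (auto intro: inv_into_into f_inv_into_f)
        have "restrict g T \<in> ?P" using g eV by (intro restrict_PiE_iff[THEN iffD2]) blast
        moreover have "restrict g T ` T = e"
        proof -
          have "g ` T \<subseteq> e" using g by blast
          moreover have "g (c x) = x" if "x \<in> e" for x
            unfolding g_def using inj that by (rule inv_into_f_f)
          then have "e \<subseteq> g ` T" using ce by (metis imageI subsetI)
          ultimately show ?thesis by simp
        qed
        ultimately show "e \<in> (\<lambda>f. f ` T) ` ?P"
          by (intro image_eqI[where x = "restrict g T"]) simp_all
      qed
    qed
  qed
  then have "card {e \<in> rainbow k V c. c ` e = T} = card ?P"
    by (simp add: bij_betw_same_card)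
  then show ?thesis using T by (simp add: card_PiE)
qed

text \<open>The elementary symmetric polynomial of degree \<open>k\<close> in the variables
  \<open>a i\<close>. At the part sizes it counts rainbow \<open>k\<close>-sets, which turns
  statements on blowups into inequalities for polynomials.\<close>

definition esym :: "nat \<Rightarrow> 'i set \<Rightarrow> ('i \<Rightarrow> real) \<Rightarrow> real" where
  "esym k A a = (\<Sum>T\<in>nsets A k. \<Prod>i\<in>T. a i)"

lemma rainbow_image_colors:
  "e \<in> rainbow k V c \<Longrightarrow> c \<in> V \<rightarrow> A \<Longrightarrow> c ` e \<in> nsets A k"
  by (auto simp: rainbow_def nsets_def card_image)

lemma card_rainbow:
  assumes "finite V" "finite A" "c \<in> V \<rightarrow> A"
  shows "real (card (rainbow k V c)) = esym k A (\<lambda>i. real (card {x \<in> V. c x = i}))"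
proof -
  have "card (rainbow k V c) = (\<Sum>e\<in>rainbow k V c. 1)" by simp
  also have "\<dots> = (\<Sum>T\<in>nsets A k. \<Sum>e\<in>{e \<in> rainbow k V c. c ` e = T}. 1)"
    by (rule sum.group[symmetric])
      (use assms rainbow_image_colors finite_rainbow finite_imp_finite_nsets in blast)+
  also have "\<dots> = (\<Sum>T\<in>nsets A k. \<Prod>i\<in>T. card {x \<in> V. c x = i})"
  proof (rule sum.cong[OF refl])
    fix T assume "T \<in> nsets A k"
    then show "(\<Sum>e\<in>{e \<in> rainbow k V c. c ` e = T}. 1) = (\<Prod>i\<in>T. card {x \<in> V. c x = i})"
      using card_rainbow_type[OF assms(1), of T k c] by (auto simp: nsets_def)
  qed
  finally show ?thesis by (simp add: esym_def)
qed

lemma nsets_Suc_insert: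
  assumes "i \<notin> A" "finite A"
  shows "nsets (insert i A) (Suc k) = nsets A (Suc k) \<union> insert i ` nsets A k"
proof (intro set_eqI iffI)
  fix T assume T: "T \<in> nsets (insert i A) (Suc k)"
  show "T \<in> nsets A (Suc k) \<union> insert i ` nsets A k"
  proof (cases "i \<in> T")
    case True
    then have "T - {i} \<in> nsets A k" "T = insert i (T - {i})"
      using T by (auto simp: nsets_def card_Diff_singleton)
    then show ?thesis by blast
  next
    case False
    then show ?thesis using T by (auto simp: nsets_def)
  qed
next
  fix T assume "T \<in> nsets A (Suc k) \<union> insert i ` nsets A k"
  then show "T \<in> nsets (insert i A) (Suc k)"
  proof
    assume "T \<in> insert i ` nsets A k"
    then obtain S where S: "T = insert i S" "S \<subseteq> A" "finite S" "card S = k" by (auto simp: nsets_def)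
    then have "card T = Suc k" using assms(1) by (simp add: subset_iff card_insert_if) blast
    then show ?thesis using S by (auto simp: nsets_def)
  qed (auto simp: nsets_def)
qed

lemma esym_Suc_insert:
  assumes "i \<notin> A" "finite A"
  shows "esym (Suc k) (insert i A) a = esym (Suc k) A a + a i * esym k A a"
proof -
  have iS: "i \<notin> S" "finite S" if "S \<in> nsets A k" for S
    using that assms by (auto simp: nsets_def)
  have "esym (Suc k) (insert i A) a
      = esym (Suc k) A a + (\<Sum>T\<in>insert i ` nsets A k. \<Prod>i\<in>T. a i)"
    unfolding esym_def nsets_Suc_insert[OF assms]
    by (rule sum.union_disjoint) (use assms in \<open>auto simp: finite_imp_finite_nsets nsets_def\<close>)
  also have "(\<Sum>T\<in>insert i ` nsets A k. \<Prod>i\<in>T. a i) = (\<Sum>S\<in>nsets A k. \<Prod>i\<in>insert i S. a i)"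
    by (subst sum.reindex) (use iS in \<open>auto simp: inj_on_def insert_ident\<close>)
  also have "\<dots> = (\<Sum>S\<in>nsets A k. a i * (\<Prod>i\<in>S. a i))"
    by (rule sum.cong) (use iS in auto)
  finally show ?thesis by (simp add: esym_def sum_distrib_left)
qed

lemma esym_nonneg: "(\<And>i. i \<in> A \<Longrightarrow> a i \<ge> 0) \<Longrightarrow> esym k A a \<ge> 0"
  unfolding esym_def by (intro sum_nonneg prod_nonneg) (auto simp: nsets_def)

lemma esym_mono_set:
  assumes "A \<subseteq> B" "finite B" "\<And>i. i \<in> B \<Longrightarrow> a i \<ge> 0"
  shows "esym k A a \<le> esym k B a"
  unfolding esym_def
  by (rule sum_mono2) (use assms in \<open>auto simp: finite_imp_finite_nsets nsets_def intro!: prod_nonneg\<close>)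

text \<open>Every squarefree monomial of degree \<open>Suc k\<close> occurs in the product on the
  right. In the balancing argument this bounds the higher coefficients of the edge count by the
  lowest one.\<close>

lemma esym_Suc_le:
  assumes "finite A" "\<And>i. i \<in> A \<Longrightarrow> a i \<ge> 0"
  shows "esym (Suc k) A a \<le> esym k A a * sum a A"
  using assms
proof (induction A rule: finite_induct)
  case empty
  have *: "nsets {} (Suc k) = {}" by (auto simp: nsets_def)
  show ?case unfolding esym_def * by simp
next
  case (insert i A)
  have "esym (Suc k) (insert i A) a = esym (Suc k) A a + a i * esym k A a"
    by (rule esym_Suc_insert) (use insert in auto)
  also have "\<dots> \<le> esym k A a * (a i + sum a A)"
    using insert by (simp add: algebra_simps)
  also have "\<dots> \<le> esym k (insert i A) a * (a i + sum a A)"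
    by (intro mult_right_mono esym_mono_set add_nonneg_nonneg sum_nonneg) (use insert in auto)
  finally show ?case using insert by simp
qed

lemma esym_cong: "(\<And>i. i \<in> A \<Longrightarrow> a i = b i) \<Longrightarrow> esym k A a = esym k A b"
  unfolding esym_def by (intro sum.cong prod.cong) (auto simp: nsets_def)

lemma esym_mono:
  "(\<And>i. i \<in> A \<Longrightarrow> 0 \<le> a i \<and> a i \<le> b i) \<Longrightarrow> esym k A a \<le> esym k A b"
  unfolding esym_def by (intro sum_mono prod_mono) (auto simp: nsets_def)

lemma esym_const: "finite A \<Longrightarrow> esym k A (\<lambda>_. x) = real (card A choose k) * x ^ k"
proof -
  assume A: "finite A"
  have "esym k A (\<lambda>_. x) = (\<Sum>T\<in>nsets A k. x ^ k)"
    unfolding esym_def by (rule sum.cong) (auto simp: nsets_def)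
  then show ?thesis by (simp add: card_nsets A)
qed

text \<open>Moving weight between \<open>a i\<close> and \<open>a j\<close> fixes their sum, so only
  the last term changes. This isolates the gain from balancing two parts.\<close>

lemma esym_two_insert:
  assumes "i \<notin> R" "j \<notin> R" "i \<noteq> j" "finite R"
  shows "esym (Suc (Suc k)) (insert i (insert j R)) a =
    esym (Suc (Suc k)) R a + (a i + a j) * esym (Suc k) R a + a i * a j * esym k R a"
  using assms by (simp add: esym_Suc_insert algebra_simps)

section \<open>Extremal numbers and edit distance for the family of blowups\<close>

lemma multipartite_rainbow:
  "finite V \<Longrightarrow> c \<in> V \<rightarrow> {1..t} \<Longrightarrow> multipartite r t (V, rainbow r V c)"
  by (auto simp: multipartite_def)

text \<open>The definition of \<open>max_edges\<close> uses \<open>Max\<close>, which has its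
  meaning only for finite nonempty sets. There are infinitely many blowups on \<open>n\<close>
  vertices, but only finitely many edge numbers.\<close>

lemma max_edges_set:
  assumes "r \<ge> 2"
  shows "finite {card (edges G) | G. G \<in> blowups r (complete_hgraph r t) \<and> card (verts G) = n}"
    and "x \<in> {card (edges G) | G. G \<in> blowups r (complete_hgraph r t) \<and> card (verts G) = n} \<Longrightarrow> x \<le> n ^ r"
proof -
  have *: "x \<le> n ^ r"
    if x: "x \<in> {card (edges G) | G. G \<in> blowups r (complete_hgraph r t) \<and> card (verts G) = n}" for x
  proof -
    obtain G :: "nat hgraph" where G: "x = card (edges G)" "multipartite r t G" "card (verts G) = n"
      using x unfolding blowups_complete_iff[OF assms] by blast
    then have "finite (verts G)" "edges G \<subseteq> nsets (verts G) r"
      by (auto simp: multipartite_def rainbow_def)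
    then have "card (edges G) \<le> card (nsets (verts G) r)" "card (nsets (verts G) r) \<le> card (verts G) ^ r"
      by (auto intro!: card_mono finite_imp_finite_nsets card_nsets_le simp del: card_nsets)
    then show ?thesis using G by (metis order_trans)
  qed
  then show "x \<in> {card (edges G) | G. G \<in> blowups r (complete_hgraph r t) \<and> card (verts G) = n} \<Longrightarrow> x \<le> n ^ r" .
  show "finite {card (edges G) | G. G \<in> blowups r (complete_hgraph r t) \<and> card (verts G) = n}"
    by (rule finite_subset[OF _ finite_atMost[of "n ^ r"]], rule subsetI, rule atMost_iff[THEN iffD2], erule *)
qed

lemma card_rainbow_le_max_edges:
  fixes V :: "nat set"
  assumes "r \<ge> 2" "finite V" "c \<in> V \<rightarrow> {1..t}"
  shows "card (rainbow r V c) \<le> max_edges (blowups r (complete_hgraph r t)) (card V)"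
  unfolding max_edges_def
proof (rule Max_ge[OF max_edges_set(1)[OF assms(1)]], rule CollectI, intro exI conjI)
  show "(V, rainbow r V c) \<in> blowups r (complete_hgraph r t)"
    using multipartite_rainbow[OF assms(2,3)] blowups_complete_iff[OF assms(1)] by blast
qed simp_all

lemma max_edges_le:
  assumes "r \<ge> 2" "t \<ge> 1"
  shows "max_edges (blowups r (complete_hgraph r t)) n \<le> n ^ r"
proof -
  \<comment> \<open>A constant coloring witnesses that the set under \<open>Max\<close> is
    nonempty.\<close>
  have "multipartite r t ({..<n}, rainbow r {..<n} (\<lambda>_. 1::nat))"
    using assms by (intro multipartite_rainbow) auto
  then have "{card (edges G) | G. G \<in> blowups r (complete_hgraph r t) \<and> card (verts G) = n} \<noteq> {}"
    using assms(1) by (force simp: blowups_complete_iff)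
  then have "max_edges (blowups r (complete_hgraph r t)) n
     \<in> {card (edges G) | G. G \<in> blowups r (complete_hgraph r t) \<and> card (verts G) = n}"
    unfolding max_edges_def by (rule Max_in[OF max_edges_set(1)[OF assms(1)]])
  then show ?thesis by (rule max_edges_set(2)[OF assms(1)])
qed

lemma equitable_coloring:
  assumes "finite V" "t \<ge> 1"
  obtains c where "c \<in> V \<rightarrow> {1..t}" "\<And>i. i \<in> {1..t} \<Longrightarrow> card {x \<in> V. c x = i} \<ge> card V div t"
proof -
  obtain h where h: "bij_betw h V {0..<card V}"
    using ex_bij_betw_finite_nat[OF assms(1)] by blast
  \<comment> \<open>Color by the residue of the position modulo \<open>t\<close>, shifted as colors
    start at 1. Class \<open>i\<close> contains the positions \<open>j * t + (i - 1)\<close> for all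
    \<open>j < card V div t\<close>.\<close>
  define c where "c x = Suc (h x mod t)" for x
  have "c \<in> V \<rightarrow> {1..t}" using assms by (auto simp: c_def Suc_le_eq)
  moreover have "card {x \<in> V. c x = i} \<ge> card V div t" if i: "i \<in> {1..t}" for i
  proof -
    define g where "g j = inv_into V h (j * t + (i - 1))" for j
    have it: "i - 1 < t" using i by auto
    have lt: "j * t + (i - 1) < card V" if "j < card V div t" for j
    proof -
      have "j * t + (i - 1) < Suc j * t" using it by simp
      also have "\<dots> \<le> (card V div t) * t" using that by (intro mult_le_mono1) simp
      also have "\<dots> \<le> card V" by simp
      finally show ?thesis .
    qed
    have hg: "h (g j) = j * t + (i - 1)" "g j \<in> V" if "j < card V div t" for j
    proof -
      have "j * t + (i - 1) \<in> h ` V" using lt[OF that] h by (auto simp: bij_betw_def)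
      then show "h (g j) = j * t + (i - 1)" "g j \<in> V"
        unfolding g_def by (auto intro: f_inv_into_f inv_into_into)
    qed
    have "inj_on g {..<card V div t}"
    proof (rule inj_onI)
      fix j j' assume "j \<in> {..<card V div t}" "j' \<in> {..<card V div t}" "g j = g j'"
      then have "j * t + (i - 1) = j' * t + (i - 1)" using hg(1) by (metis lessThan_iff)
      then show "j = j'" using assms(2) by simp
    qed
    moreover have "g ` {..<card V div t} \<subseteq> {x \<in> V. c x = i}"
    proof (rule image_subsetI)
      fix j assume "j \<in> {..<card V div t}"
      then show "g j \<in> {x \<in> V. c x = i}" using hg[of j] i it
        unfolding c_def by (simp del: add_diff_assoc add_diff_assoc2)
    qed
    ultimately show ?thesis
      using assms(1) card_inj_on_le[of g "{..<card V div t}" "{x \<in> V. c x = i}"] by simp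
  qed
  ultimately show ?thesis using that by blast
qed

text \<open>An equitable coloring loses at most one vertex per part by rounding. The condition
  \<open>n \<ge> t\<close> makes the lower bound for the part sizes nonnegative, as needed for
  monotonicity of \<open>esym\<close>.\<close>

lemma max_edges_ge:
  assumes "r \<ge> 2" "t \<ge> 1" "n \<ge> t"
  shows "real (t choose r) * (real n / real t - 1) ^ r
    \<le> real (max_edges (blowups r (complete_hgraph r t)) n)"
proof -
  obtain c where c: "c \<in> {..<n} \<rightarrow> {1..t}"
    "\<And>i. i \<in> {1..t} \<Longrightarrow> card {x \<in> {..<n}. c x = i} \<ge> card {..<n} div t"
    using equitable_coloring[of "{..<n}" t] assms by auto
  have "real n / real t - 1 \<le> real (n div t)"
  proof -
    have "real n = real (n div t) * real t + real (n mod t)"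
      by (metis div_mult_mod_eq of_nat_add of_nat_mult)
    moreover have "real (n mod t) \<le> real t" using assms by simp
    ultimately show ?thesis using assms by (simp add: field_simps)
  qed
  then have le: "real n / real t - 1 \<le> real (card {x \<in> {..<n}. c x = i})" if "i \<in> {1..t}" for i
    using c(2)[OF that] by simp
  have ge: "0 \<le> real n / real t - 1" using assms by (simp add: field_simps)
  have "real (t choose r) * (real n / real t - 1) ^ r = esym r {1..t} (\<lambda>_. real n / real t - 1)"
    by (simp add: esym_const)
  also have "\<dots> \<le> esym r {1..t} (\<lambda>i. real (card {x \<in> {..<n}. c x = i}))"
    using le ge by (intro esym_mono) auto
  also have "\<dots> = real (card (rainbow r {..<n} c))"
    by (rule card_rainbow[symmetric]) (use c in auto)
  also have "\<dots> \<le> real (max_edges (blowups r (complete_hgraph r t)) n)"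
    using card_rainbow_le_max_edges[of r "{..<n}" c t] c assms by simp
  finally show ?thesis .
qed

text \<open>Blowups on a fixed vertex set are given by colorings. The last conclusion records
  minimality against all colorings, because \<open>c\<close> will be compared with its recolorings
  at a single vertex.\<close>

lemma edit_distance_blowups:
  assumes r: "r \<ge> 2" and t: "t \<ge> 1" and G: "finite (verts G)" "edges G \<subseteq> nsets (verts G) r"
  obtains c where "c \<in> verts G \<rightarrow> {1..t}"
    "edit_distance (blowups r (complete_hgraph r t)) G
      = card (sym_diff (edges G) (rainbow r (verts G) c))"
    "\<And>c'. c' \<in> verts G \<rightarrow> {1..t} \<Longrightarrow>
      card (sym_diff (edges G) (rainbow r (verts G) c)) \<le> card (sym_diff (edges G) (rainbow r (verts G) c'))"
proof -
  let ?D = "{card (sym_diff (edges G) (edges F')) | F'.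
    F' \<in> blowups r (complete_hgraph r t) \<and> verts F' = verts G}"
  have D: "?D = {card (sym_diff (edges G) (rainbow r (verts G) c)) | c. c \<in> verts G \<rightarrow> {1..t}}" (is "_ = ?D'")
  proof
    show "?D \<subseteq> ?D'" using r by (auto simp: blowups_complete_iff multipartite_def)
    show "?D' \<subseteq> ?D"
    proof
      fix d assume "d \<in> ?D'"
      then obtain c where c: "c \<in> verts G \<rightarrow> {1..t}" "d = card (sym_diff (edges G) (rainbow r (verts G) c))"
        by blast
      then have "(verts G, rainbow r (verts G) c) \<in> blowups r (complete_hgraph r t)"
        using multipartite_rainbow[OF G(1)] r by (simp add: blowups_complete_iff)
      then show "d \<in> ?D" using c(2) by (intro CollectI exI[of _ "(verts G, rainbow r (verts G) c)"]) simp
    qed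
  qed
  have "finite ?D" unfolding D
  proof (rule finite_subset)
    show "?D' \<subseteq> {..card (nsets (verts G) r)}"
      using G(2) by (auto simp del: card_nsets simp: rainbow_def
          intro!: card_mono finite_imp_finite_nsets G(1))
  qed simp
  moreover have "?D \<noteq> {}"
  proof -
    have "(\<lambda>_. 1) \<in> verts G \<rightarrow> {1..t}" using t by auto
    then show ?thesis unfolding D by blast
  qed
  ultimately have mn: "Min ?D \<in> ?D" "\<And>d. d \<in> ?D \<Longrightarrow> Min ?D \<le> d"
    using Min_in[of ?D] Min_le[of ?D] by blast+
  have "Min ?D \<in> ?D'" using mn(1) unfolding D .
  then obtain c where c: "c \<in> verts G \<rightarrow> {1..t}"
    "Min ?D = card (sym_diff (edges G) (rainbow r (verts G) c))" by blast
  moreover have "Min ?D \<le> card (sym_diff (edges G) (rainbow r (verts G) c'))"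
    if "c' \<in> verts G \<rightarrow> {1..t}" for c'
    using mn(2) that unfolding D by blast
  ultimately show ?thesis using that[of c] unfolding edit_distance_def by simp
qed

section \<open>Embedding by counting\<close>

text \<open>A map on \<open>U\<close> is determined by its restrictions to \<open>D\<close> and to
  \<open>U - D\<close>, so the density of an event depending on \<open>D\<close> alone is the same
  among maps on \<open>U\<close>.\<close>

lemma card_restrict_bad:
  assumes "finite U" "finite V" "D \<subseteq> U" "X \<subseteq> PiE D (\<lambda>_. V)"
  shows "card {f \<in> PiE U (\<lambda>_. V). restrict f D \<in> X} \<le> card X * card V ^ card (U - D)"
proof -
  let ?B = "{f \<in> PiE U (\<lambda>_. V). restrict f D \<in> X}"
  let ?h = "\<lambda>f. (restrict f D, restrict f (U - D))"
  have finD: "finite D" using assms finite_subset by blast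
  have "inj_on ?h ?B"
  proof (rule inj_onI)
    fix f g assume f: "f \<in> ?B" and g: "g \<in> ?B" and h: "?h f = ?h g"
    have 1: "restrict f D = restrict g D" and 2: "restrict f (U - D) = restrict g (U - D)"
      using h by auto
    show "f = g"
    proof (rule PiE_ext)
      show "f \<in> PiE U (\<lambda>_. V)" "g \<in> PiE U (\<lambda>_. V)" using f g by auto
      fix x assume "x \<in> U"
      then show "f x = g x" using fun_cong[OF 1, of x] fun_cong[OF 2, of x] by (cases "x \<in> D") auto
    qed
  qed
  moreover have "?h ` ?B \<subseteq> X \<times> PiE (U - D) (\<lambda>_. V)"
    using assms(3) by (auto simp: restrict_PiE_iff PiE_mem)
  moreover have "finite (X \<times> PiE (U - D) (\<lambda>_. V))"
    using assms finD finite_PiE[of D "\<lambda>_. V"] finite_subset[OF assms(4)]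
    by (intro finite_cartesian_product finite_PiE) simp_all
  ultimately have "card ?B \<le> card (X \<times> PiE (U - D) (\<lambda>_. V))"
    by (rule card_inj_on_le)
  also have "\<dots> = card X * card V ^ card (U - D)"
    using assms by (simp add: card_cartesian_product card_PiE)
  finally show ?thesis .
qed

text \<open>Choices on different blocks are independent: they glue to one map
  \<open>\<Phi> h\<close>, from which they are recovered by restriction. Here \<open>b z\<close> is
  the block containing \<open>z\<close>.\<close>

lemma card_PiE_partition_ge:
  assumes U: "finite U" and V: "finite V"
    and P: "\<Union>P = U" "pairwise disjnt P" "{} \<notin> P"
    and A: "\<And>J. J \<in> P \<Longrightarrow> A J \<subseteq> PiE J (\<lambda>_. V)"
  shows "(\<Prod>J\<in>P. card (A J)) \<le> card {f \<in> PiE U (\<lambda>_. V). \<forall>J\<in>P. restrict f J \<in> A J}"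
proof -
  let ?Q = "{f \<in> PiE U (\<lambda>_. V). \<forall>J\<in>P. restrict f J \<in> A J}"
  have finP: "finite P" using P(1) U finite_UnionD by blast
  define b where "b z = (THE J. J \<in> P \<and> z \<in> J)" for z
  have b: "b z = J" if "J \<in> P" "z \<in> J" for z J
    unfolding b_def
  proof (rule the_equality)
    show "J \<in> P \<and> z \<in> J" using that by simp
    fix J' assume "J' \<in> P \<and> z \<in> J'"
    then show "J' = J" using that P(2) unfolding pairwise_def disjnt_def by blast
  qed
  define \<Phi> where "\<Phi> h = (\<lambda>z\<in>U. h (b z) z)" for h :: "'a set \<Rightarrow> 'a \<Rightarrow> 'b"
  have res: "restrict (\<Phi> h) J = h J" if h: "h \<in> PiE P A" and J: "J \<in> P" for h J
  proof
    fix z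
    have hJ: "h J \<in> PiE J (\<lambda>_. V)" using A[OF J] PiE_mem[OF h J] by blast
    show "restrict (\<Phi> h) J z = h J z"
    proof (cases "z \<in> J")
      case True
      then have "z \<in> U" using J P(1) by blast
      then show ?thesis using True b[OF J True] by (simp add: \<Phi>_def)
    next
      case False
      then show ?thesis using PiE_arb[OF hJ False] by simp
    qed
  qed
  have "inj_on \<Phi> (PiE P A)"
  proof (rule inj_onI)
    fix h h' assume hh: "h \<in> PiE P A" "h' \<in> PiE P A" "\<Phi> h = \<Phi> h'"
    show "h = h'"
    proof (rule PiE_ext[OF hh(1,2)])
      fix J assume "J \<in> P"
      then show "h J = h' J" using res hh by metis
    qed
  qed
  moreover have "\<Phi> ` PiE P A \<subseteq> ?Q"
  proof (rule image_subsetI)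
    fix h assume h: "h \<in> PiE P A"
    have "\<Phi> h \<in> PiE U (\<lambda>_. V)"
      unfolding \<Phi>_def
    proof (rule restrict_PiE_iff[THEN iffD2], rule ballI)
      fix z assume "z \<in> U"
      then obtain J where J: "J \<in> P" "z \<in> J" using P(1) by blast
      have "h J \<in> PiE J (\<lambda>_. V)" using A[OF J(1)] PiE_mem[OF h J(1)] by blast
      then show "h (b z) z \<in> V" using b[OF J] PiE_mem J(2) by fastforce
    qed
    moreover have "\<forall>J\<in>P. restrict (\<Phi> h) J \<in> A J" using res[OF h] PiE_mem[OF h] by simp
    ultimately show "\<Phi> h \<in> ?Q" by simp
  qed
  moreover have "finite ?Q" using U V finite_PiE[of U "\<lambda>_. V"] by simp
  ultimately have "card (PiE P A) \<le> card ?Q" by (rule card_inj_on_le)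
  then show ?thesis using finP by (simp add: card_PiE)
qed

text \<open>
  The counting argument behind both embeddings of \<open>H\<close>: a map \<open>f\<close> is composed of independent
  choices from \<open>A J\<close> on the blocks \<open>J\<close> of a partition of \<open>U\<close>, and each of the events \<open>X k\<close>,
  which constrains \<open>f\<close> on \<open>D k\<close> only, is too rare for all choices to be bad.
\<close>

lemma exists_avoiding:
  fixes g \<delta> :: real and n :: nat
  assumes U: "finite U" and V: "finite V" "card V = n" "n > 0"
    and P: "\<Union>P = U" "pairwise disjnt P" "{} \<notin> P"
    and A: "\<And>J. J \<in> P \<Longrightarrow> A J \<subseteq> PiE J (\<lambda>_. V)"
    and Ag: "\<And>J. J \<in> P \<Longrightarrow> real (card (A J)) \<ge> g * real n ^ card J" and g: "g > 0"
    and K: "finite K" and D: "\<And>k. k \<in> K \<Longrightarrow> D k \<subseteq> U"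
    and X: "\<And>k. k \<in> K \<Longrightarrow> X k \<subseteq> PiE (D k) (\<lambda>_. V)"
    and Xd: "\<And>k. k \<in> K \<Longrightarrow> real (card (X k)) \<le> \<delta> * real n ^ card (D k)"
    and small: "real (card K) * \<delta> < g ^ card P"
  obtains f where "f \<in> PiE U (\<lambda>_. V)" "\<And>J. J \<in> P \<Longrightarrow> restrict f J \<in> A J"
    "\<And>k. k \<in> K \<Longrightarrow> restrict f (D k) \<notin> X k"
proof -
  let ?Q = "{f \<in> PiE U (\<lambda>_. V). \<forall>J\<in>P. restrict f J \<in> A J}"
  let ?B = "\<lambda>k. {f \<in> PiE U (\<lambda>_. V). restrict f (D k) \<in> X k}"
  have finU: "finite (PiE U (\<lambda>_. V))" using U V by (simp add: finite_PiE)
  have finP: "finite P" using P(1) U finite_UnionD by blast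
  have fJ: "finite J" if "J \<in> P" for J using that P(1) U by (metis Sup_upper finite_subset)
  have cU: "card U = (\<Sum>J\<in>P. card J)"
    using card_Union_disjoint[OF P(2)] fJ P(1) by simp
  \<comment> \<open>The block sizes add up to \<open>card U\<close>, so block densities
    \<open>g\<close> multiply to a proportion \<open>g ^ card P\<close> of all
    \<open>n ^ card U\<close> maps. The union bound below is compared with this.\<close>
  have "g ^ card P * real n ^ card U = (\<Prod>J\<in>P. g * real n ^ card J)"
    using finP by (simp add: cU prod.distrib power_sum)
  also have "\<dots> \<le> (\<Prod>J\<in>P. real (card (A J)))"
    using Ag g by (intro prod_mono) auto
  also have "\<dots> \<le> real (card ?Q)"
    using of_nat_mono[OF card_PiE_partition_ge[OF U V(1) P A], where ?'a = real] by simp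
  finally have Q: "g ^ card P * real n ^ card U \<le> real (card ?Q)" .
  have B: "real (card (?B k)) \<le> \<delta> * real n ^ card U" if k: "k \<in> K" for k
  proof -
    have "card (?B k) \<le> card (X k) * n ^ card (U - D k)"
      using card_restrict_bad[OF U V(1) D[OF k] X[OF k]] V(2) by simp
    then have "real (card (?B k)) \<le> real (card (X k)) * real n ^ card (U - D k)"
      using of_nat_mono[where ?'a = real] by fastforce
    also have "\<dots> \<le> (\<delta> * real n ^ card (D k)) * real n ^ card (U - D k)"
      using Xd[OF k] by (intro mult_right_mono) auto
    also have "\<dots> = \<delta> * real n ^ card U"
    proof -
      have "card U = card (D k) + card (U - D k)"
        using D[OF k] U by (metis card_Diff_subset card_mono finite_subset le_add_diff_inverse)
      then show ?thesis by (simp add: power_add)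
    qed
    finally show ?thesis .
  qed
  have "real (card (\<Union>k\<in>K. ?B k)) \<le> (\<Sum>k\<in>K. real (card (?B k)))"
    using of_nat_mono[OF card_UN_le[OF K, of ?B], where ?'a = real] by simp
  also have "\<dots> \<le> (\<Sum>k\<in>K. \<delta> * real n ^ card U)" by (rule sum_mono) (rule B)
  also have "\<dots> = real (card K) * \<delta> * real n ^ card U" by simp
  also have "\<dots> < g ^ card P * real n ^ card U" using small V(3) by simp
  also have "\<dots> \<le> real (card ?Q)" by (rule Q)
  finally have less: "card (\<Union>k\<in>K. ?B k) < card ?Q" by simp
  have "\<not> ?Q \<subseteq> (\<Union>k\<in>K. ?B k)"
  proof
    assume "?Q \<subseteq> (\<Union>k\<in>K. ?B k)"
    then have "card ?Q \<le> card (\<Union>k\<in>K. ?B k)"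
      by (intro card_mono) (use K finU in auto)
    then show False using less by simp
  qed
  then obtain f where "f \<in> ?Q" "f \<notin> (\<Union>k\<in>K. ?B k)" by blast
  then show ?thesis using that[of f] by blast
qed

text \<open>Collisions \<open>f z = f z'\<close> and hits \<open>f z \<in> W\<close> are treated as
  further rare events, which accounts for \<open>card U ^ 2 + card U\<close> in the smallness
  condition. A collision allows at most \<open>n\<close> of the \<open>n ^ 2\<close> pairs of
  values, a proportion covered by \<open>1 \<le> \<delta> * real n\<close>. In the applications
  \<open>W\<close> consists of the vertices of \<open>G\<close> used before \<open>f\<close> is
  chosen.\<close>

lemma exists_injective_avoiding:
  fixes g \<delta> :: real and n :: nat
  assumes U: "finite U" and V: "finite V" "card V = n" "n > 0"
    and P: "\<Union>P = U" "pairwise disjnt P" "{} \<notin> P"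
    and A: "\<And>J. J \<in> P \<Longrightarrow> A J \<subseteq> PiE J (\<lambda>_. V)"
    and Ag: "\<And>J. J \<in> P \<Longrightarrow> real (card (A J)) \<ge> g * real n ^ card J" and g: "g > 0"
    and K: "finite K" and D: "\<And>k. k \<in> K \<Longrightarrow> D k \<subseteq> U"
    and X: "\<And>k. k \<in> K \<Longrightarrow> X k \<subseteq> PiE (D k) (\<lambda>_. V)"
    and Xd: "\<And>k. k \<in> K \<Longrightarrow> real (card (X k)) \<le> \<delta> * real n ^ card (D k)"
    and W: "finite W" "real (card W) \<le> \<delta> * real n" and one: "1 \<le> \<delta> * real n"
    and small: "real (card K + card U ^ 2 + card U) * \<delta> < g ^ card P"
  obtains f where "f \<in> PiE U (\<lambda>_. V)" "\<And>J. J \<in> P \<Longrightarrow> restrict f J \<in> A J"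
    "\<And>k. k \<in> K \<Longrightarrow> restrict f (D k) \<notin> X k" "inj_on f U" "f ` U \<inter> W = {}"
proof -
  \<comment> \<open>Events are represented by pairs of a domain and a set of forbidden restrictions,
    so that the three kinds form one family with projections \<open>fst\<close> and
    \<open>snd\<close>.\<close>
  define Kn where "Kn = (\<lambda>(z, z'). ({z, z'}, {h \<in> PiE {z, z'} (\<lambda>_. V). h z = h z'})) ` {p \<in> U \<times> U. fst p \<noteq> snd p}"
  define Kw where "Kw = (\<lambda>z. ({z}, {h \<in> PiE {z} (\<lambda>_. V). h z \<in> W})) ` U"
  define L where "L = (\<lambda>k. (D k, X k)) ` K \<union> Kn \<union> Kw"
  have \<delta>: "\<delta> > 0" using one by (metis V(3) linorder_not_le mult_nonpos_nonneg not_one_le_zero of_nat_0_le_iff order_trans)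
  have "card Kn \<le> card U ^ 2"
  proof -
    have "card Kn \<le> card {p \<in> U \<times> U. fst p \<noteq> snd p}"
      unfolding Kn_def using U by (intro card_image_le finite_Collect_conjI) auto
    also have "\<dots> \<le> card (U \<times> U)" using U by (intro card_mono) auto
    finally show ?thesis by (simp add: card_cartesian_product power2_eq_square)
  qed
  moreover have "card Kw \<le> card U" unfolding Kw_def using U by (rule card_image_le)
  moreover have "card ((\<lambda>k. (D k, X k)) ` K) \<le> card K" using K by (rule card_image_le)
  moreover have "card L \<le> card ((\<lambda>k. (D k, X k)) ` K) + card Kn + card Kw"
    unfolding L_def by (meson card_Un_le add_le_mono1 le_trans)
  ultimately have "real (card L) \<le> real (card K + card U ^ 2 + card U)" by linarith
  then have "real (card L) * \<delta> \<le> real (card K + card U ^ 2 + card U) * \<delta>"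
    using \<delta> by (intro mult_right_mono) auto
  then have small': "real (card L) * \<delta> < g ^ card P" using small by linarith
  have finL: "finite L" unfolding L_def Kn_def Kw_def using U K by auto
  have L: "fst k \<subseteq> U \<and> snd k \<subseteq> PiE (fst k) (\<lambda>_. V) \<and> real (card (snd k)) \<le> \<delta> * real n ^ card (fst k)"
    if k: "k \<in> L" for k
  proof -
    consider "k \<in> (\<lambda>k. (D k, X k)) ` K" | "k \<in> Kn" | "k \<in> Kw" using k L_def by blast
    then show ?thesis
    proof cases
      case 1
      then obtain i where "i \<in> K" "k = (D i, X i)" by blast
      then show ?thesis using D[of i] X[of i] Xd[of i] by simp
    next
      case 2
      then obtain z z' where z: "z \<in> U" "z' \<in> U" "z \<noteq> z'"
        and k: "k = ({z, z'}, {h \<in> PiE {z, z'} (\<lambda>_. V). h z = h z'})"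
        unfolding Kn_def by auto
      have "card {h \<in> PiE {z, z'} (\<lambda>_. V). h z = h z'} \<le> card V"
      proof (rule card_inj_on_le[of "\<lambda>h. h z"])
        show "inj_on (\<lambda>h. h z) {h \<in> PiE {z, z'} (\<lambda>_. V). h z = h z'}"
        proof (rule inj_onI)
          fix h h' assume h: "h \<in> {h \<in> PiE {z, z'} (\<lambda>_. V). h z = h z'}"
            "h' \<in> {h \<in> PiE {z, z'} (\<lambda>_. V). h z = h z'}" "h z = h' z"
          show "h = h'"
            by (rule PiE_ext[of h "{z, z'}" "\<lambda>_. V"]) (use h in auto)
        qed
      qed (use V in auto)
      then have "real (card (snd k)) \<le> 1 * real n" using k V by simp
      also have "\<dots> \<le> (\<delta> * real n) * real n" using one by (intro mult_right_mono) auto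
      finally show ?thesis using k z by (auto simp: power2_eq_square algebra_simps)
    next
      case 3
      then obtain z where z: "z \<in> U"
        and k: "k = ({z}, {h \<in> PiE {z} (\<lambda>_. V). h z \<in> W})"
        unfolding Kw_def by auto
      have "card {h \<in> PiE {z} (\<lambda>_. V). h z \<in> W} \<le> card W"
      proof (rule card_inj_on_le[of "\<lambda>h. h z"])
        show "inj_on (\<lambda>h. h z) {h \<in> PiE {z} (\<lambda>_. V). h z \<in> W}"
        proof (rule inj_onI)
          fix h h' assume h: "h \<in> {h \<in> PiE {z} (\<lambda>_. V). h z \<in> W}"
            "h' \<in> {h \<in> PiE {z} (\<lambda>_. V). h z \<in> W}" "h z = h' z"
          show "h = h'"
            by (rule PiE_ext[of h "{z}" "\<lambda>_. V"]) (use h in auto)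
        qed
      qed (use W in auto)
      then have "real (card (snd k)) \<le> \<delta> * real n" using k W(2) by simp
      then show ?thesis using k z by auto
    qed
  qed
  obtain f where f: "f \<in> PiE U (\<lambda>_. V)" "\<And>J. J \<in> P \<Longrightarrow> restrict f J \<in> A J"
    "\<And>k. k \<in> L \<Longrightarrow> restrict f (fst k) \<notin> snd k"
    by (rule exists_avoiding[OF U V P A Ag g finL, of fst snd \<delta>]) (use L small' in auto)
  have "restrict f (D k) \<notin> X k" if "k \<in> K" for k
    using f(3)[of "(D k, X k)"] that by (simp add: L_def)
  moreover have "inj_on f U"
  proof (rule inj_onI, rule ccontr)
    fix z z' assume z: "z \<in> U" "z' \<in> U" "f z = f z'" "z \<noteq> z'"
    have "({z, z'}, {h \<in> PiE {z, z'} (\<lambda>_. V). h z = h z'}) \<in> L"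
      unfolding L_def Kn_def using z by (intro UnI1 UnI2 image_eqI[of _ _ "(z, z')"]) auto
    from f(3)[OF this] show False using z f(1) by (auto simp: PiE_mem)
  qed
  moreover have "f ` U \<inter> W = {}"
  proof (rule ccontr)
    assume "f ` U \<inter> W \<noteq> {}"
    then obtain z where z: "z \<in> U" "f z \<in> W" by blast
    have "({z}, {h \<in> PiE {z} (\<lambda>_. V). h z \<in> W}) \<in> L"
      unfolding L_def Kw_def using z by (intro UnI2 image_eqI[of _ _ z]) auto
    from f(3)[OF this] show False using z f(1) by (auto simp: PiE_mem)
  qed
  ultimately show ?thesis using that[OF f(1,2)] by blast
qed

lemma card_colored_maps_le:
  assumes M: "finite M" "\<And>e. e \<in> M \<Longrightarrow> inj_on c e"
    and X: "X \<subseteq> PiE D (\<lambda>_. V)"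
    and col: "\<And>h z. h \<in> X \<Longrightarrow> z \<in> D \<Longrightarrow> c (h z) = \<chi> z"
    and QM: "\<And>h. h \<in> X \<Longrightarrow> Q \<union> h ` D \<in> M"
  shows "card X \<le> card M"
proof (rule card_inj_on_le[of "\<lambda>h. Q \<union> h ` D"])
  show "inj_on (\<lambda>h. Q \<union> h ` D) X"
  proof (rule inj_onI)
    fix h h' assume h: "h \<in> X" "h' \<in> X" "Q \<union> h ` D = Q \<union> h' ` D"
    show "h = h'"
    proof (rule PiE_ext)
      show "h \<in> PiE D (\<lambda>_. V)" "h' \<in> PiE D (\<lambda>_. V)" using h X by auto
      fix z assume z: "z \<in> D"
      have "inj_on c (Q \<union> h ` D)" using M(2) QM h(1) by blast
      moreover have "h z \<in> Q \<union> h ` D" using z by blast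
      moreover have "h' z \<in> Q \<union> h ` D" unfolding h(3) using z by blast
      moreover have "c (h z) = c (h' z)" using col z h by simp
      ultimately show "h z = h' z" by (simp add: inj_on_eq_iff)
    qed
  qed
qed (use QM M in auto)

lemma card_colored_maps_ge:
  assumes V: "finite V" and J: "finite J" and L: "\<And>I. I \<in> L \<Longrightarrow> I \<subseteq> V \<and> inj_on c I \<and> c ` I = \<phi> ` J"
    and inj: "inj_on \<phi> J"
  shows "card L \<le> card {h \<in> PiE J (\<lambda>_. V). (\<forall>z\<in>J. c (h z) = \<phi> z) \<and> h ` J \<in> L}"
proof (rule card_inj_on_le[of "\<lambda>I. \<lambda>z\<in>J. inv_into I c (\<phi> z)"])
  have im: "(\<lambda>z\<in>J. inv_into I c (\<phi> z)) ` J = I" if "I \<in> L" for I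
  proof -
    have "(\<lambda>z\<in>J. inv_into I c (\<phi> z)) ` J = inv_into I c ` (\<phi> ` J)"
      by (simp add: image_image)
    also have "\<dots> = inv_into I c ` (c ` I)" using L[OF that] by simp
    also have "\<dots> = I" using L[OF that] by (intro inv_into_image_cancel) auto
    finally show ?thesis .
  qed
  show "inj_on (\<lambda>I. \<lambda>z\<in>J. inv_into I c (\<phi> z)) L"
    by (rule inj_on_inverseI[of _ "\<lambda>h. h ` J"]) (rule im)
  show "(\<lambda>I. \<lambda>z\<in>J. inv_into I c (\<phi> z)) ` L \<subseteq> {h \<in> PiE J (\<lambda>_. V). (\<forall>z\<in>J. c (h z) = \<phi> z) \<and> h ` J \<in> L}"
  proof (rule image_subsetI)
    fix I assume I: "I \<in> L"
    have 1: "\<phi> z \<in> c ` I" if "z \<in> J" for z using L[OF I] that by simp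
    have "inv_into I c (\<phi> z) \<in> V" "c (inv_into I c (\<phi> z)) = \<phi> z" if "z \<in> J" for z
      using inv_into_into[OF 1[OF that]] f_inv_into_f[OF 1[OF that]] L[OF I] by auto
    then show "(\<lambda>z\<in>J. inv_into I c (\<phi> z)) \<in> {h \<in> PiE J (\<lambda>_. V). (\<forall>z\<in>J. c (h z) = \<phi> z) \<and> h ` J \<in> L}"
      using im[OF I] I by (simp add: restrict_PiE_iff)
  qed
  show "finite {h \<in> PiE J (\<lambda>_. V). (\<forall>z\<in>J. c (h z) = \<phi> z) \<and> h ` J \<in> L}"
    using V J finite_PiE[of J "\<lambda>_. V"] by simp
qed

lemma rainbow_image:
  assumes "\<And>z. z \<in> D \<Longrightarrow> c (f z) = \<chi> z" "inj_on \<chi> D" "f ` D \<subseteq> V" "finite D" "card D = k"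
  shows "f ` D \<in> rainbow k V c"
proof -
  have "inj_on (c \<circ> f) D" using assms(1,2) by (simp add: inj_on_def)
  then have "inj_on f D" "inj_on c (f ` D)" by (auto intro: inj_on_imageI2 inj_on_imageI)
  then show ?thesis using assms by (auto simp: rainbow_def nsets_def card_image)
qed

section \<open>Edges inside a color class and colors of links\<close>

text \<open>Every coloring of \<open>H\<close> without \<open>F\<close> gives the critical vertices
  \<open>u\<close> and \<open>w\<close> the same color. Otherwise the \<open>r - 2\<close> free
  vertices, which lie in no other edge, could receive distinct colors among the remaining
  \<open>t - 2\<close>, and all of \<open>H\<close> would be strongly colorable.\<close>

lemma freely_critical_coloring:
  assumes r: "r \<ge> 2" "t \<ge> r" and H: "rgraph r H" and F: "freely_critical r t H F" and a: "a \<in> {1..t}"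
  obtains \<chi> u w where "u \<noteq> w" "F - free_vertices H F = {u, w}" "\<chi> \<in> verts H \<rightarrow> {1..t}"
    "\<And>e. e \<in> edges H \<Longrightarrow> e \<noteq> F \<Longrightarrow> inj_on \<chi> e" "\<chi> u = a" "\<chi> w = a"
proof -
  let ?R = "free_vertices H F"
  have FH: "F \<in> edges H" and ncol: "\<not> strongly_colorable t H" and cR: "card ?R = r - 2"
    using F by (auto simp: freely_critical_def critical_edge_def)
  have Fv: "F \<subseteq> verts H" "finite F" "card F = r"
    using FH H by (auto simp: rgraph_def nsets_def)
  have RF: "?R \<subseteq> F" "finite ?R" using Fv finite_subset by (auto simp: free_vertices_def)
  then have "card (F - ?R) = 2" using cR Fv r by (simp add: card_Diff_subset)
  then obtain u w where uw: "F - ?R = {u, w}" "u \<noteq> w" by (auto simp: card_2_iff)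
  obtain \<chi> where \<chi>: "\<chi> \<in> verts H \<rightarrow> {1..t}" and ic: "\<And>e. e \<in> edges H \<Longrightarrow> e \<noteq> F \<Longrightarrow> inj_on \<chi> e"
    using F by (auto simp: freely_critical_def critical_edge_def strongly_colorable_def)
  have uwF: "u \<in> F" "w \<in> F" "u \<notin> ?R" "w \<notin> ?R" using uw by auto
  have eq: "\<chi> u = \<chi> w"
  proof (rule ccontr)
    assume ne: "\<chi> u \<noteq> \<chi> w"
    have uwt: "\<chi> u \<in> {1..t}" "\<chi> w \<in> {1..t}" using Pi_mem[OF \<chi>] uwF Fv(1) by blast+
    have "card ({1..t} - {\<chi> u, \<chi> w}) = t - 2"
      using uwt ne by (simp add: card_Diff_subset del: atLeastAtMost_iff)
    then obtain q where q: "q ` ?R \<subseteq> {1..t} - {\<chi> u, \<chi> w}" "inj_on q ?R"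
      using card_le_inj[of ?R "{1..t} - {\<chi> u, \<chi> w}"] RF cR diff_le_mono[OF r(2), of 2] by auto
    define \<chi>' where "\<chi>' z = (if z \<in> ?R then q z else \<chi> z)" for z
    have "\<chi>' z \<in> {1..t}" if "z \<in> verts H" for z
      using q(1) Pi_mem[OF \<chi> that] unfolding \<chi>'_def by (cases "z \<in> ?R") auto
    then have "\<chi>' \<in> verts H \<rightarrow> {1..t}" by blast
    moreover have "inj_on \<chi>' e" if e: "e \<in> edges H" for e
    proof (cases "e = F")
      case True
      have F_eq: "F = ?R \<union> {u, w}" using uw RF by blast
      have "inj_on \<chi>' ?R" using q(2) by (simp add: \<chi>'_def inj_on_def)
      moreover have "inj_on \<chi>' {u, w}" using ne uwF by (simp add: \<chi>'_def inj_on_def)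
      moreover have "\<chi>' ` (?R - {u, w}) \<inter> \<chi>' ` ({u, w} - ?R) = {}"
        using q(1) uwF by (auto simp: \<chi>'_def)
      ultimately have "inj_on \<chi>' (?R \<union> {u, w})" unfolding inj_on_Un by blast
      then show ?thesis unfolding True by (simp only: F_eq[symmetric])
    next
      case False
      have "z \<notin> ?R" if "z \<in> e" for z using that False e by (auto simp: free_vertices_def)
      then have "inj_on \<chi>' e = inj_on \<chi> e" by (intro inj_on_cong) (simp add: \<chi>'_def)
      then show ?thesis using ic[OF e False] by simp
    qed
    ultimately show False using ncol unfolding strongly_colorable_def by blast
  qed
  \<comment> \<open>transposing two colors moves the common color of \<open>u\<close> and \<open>w\<close> to \<open>a\<close>\<close>
  define \<pi> where "\<pi> j = (if j = \<chi> u then a else if j = a then \<chi> u else j)" for j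
  have inj: "inj \<pi>" by (auto simp: \<pi>_def inj_on_def split: if_splits)
  have "\<chi> u \<in> {1..t}" using Pi_mem[OF \<chi>] uwF Fv(1) by blast
  then have "\<pi> \<circ> \<chi> \<in> verts H \<rightarrow> {1..t}"
    using a Pi_mem[OF \<chi>] by (auto simp: \<pi>_def simp del: atLeastAtMost_iff)
  moreover have "inj_on (\<pi> \<circ> \<chi>) e" if "e \<in> edges H" "e \<noteq> F" for e
    using ic[OF that] inj by (auto intro: comp_inj_on inj_on_subset)
  moreover have "(\<pi> \<circ> \<chi>) u = a" "(\<pi> \<circ> \<chi>) w = a" using eq by (auto simp: \<pi>_def)
  ultimately show ?thesis using that[OF uw(2,1)] by blast
qed

lemma disjoint_singletons: "pairwise disjnt ((\<lambda>z. {z}) ` Z)"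
  by (auto simp: pairwise_def disjnt_def)

lemma card_color_class:
  "card {h \<in> PiE {z} (\<lambda>_. V). c (h z) = i} = card {x \<in> V. c x = i}"
proof (rule bij_betw_same_card[of "\<lambda>h. h z"])
  show "bij_betw (\<lambda>h. h z) {h \<in> PiE {z} (\<lambda>_. V). c (h z) = i} {x \<in> V. c x = i}"
    unfolding bij_betw_def
  proof
    show "inj_on (\<lambda>h. h z) {h \<in> PiE {z} (\<lambda>_. V). c (h z) = i}"
    proof (rule inj_onI)
      fix h h' assume "h \<in> {h \<in> PiE {z} (\<lambda>_. V). c (h z) = i}"
        "h' \<in> {h \<in> PiE {z} (\<lambda>_. V). c (h z) = i}" "h z = h' z"
      then show "h = h'" by (intro PiE_ext[of h "{z}" "\<lambda>_. V"]) auto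
    qed
    show "(\<lambda>h. h z) ` {h \<in> PiE {z} (\<lambda>_. V). c (h z) = i} = {x \<in> V. c x = i}"
    proof
      show "{x \<in> V. c x = i} \<subseteq> (\<lambda>h. h z) ` {h \<in> PiE {z} (\<lambda>_. V). c (h z) = i}"
      proof
        fix x assume "x \<in> {x \<in> V. c x = i}"
        then show "x \<in> (\<lambda>h. h z) ` {h \<in> PiE {z} (\<lambda>_. V). c (h z) = i}"
          by (intro image_eqI[of _ _ "\<lambda>y\<in>{z}. x"]) auto
      qed
    qed auto
  qed
qed

text \<open>\<open>F\<close> is placed on \<open>e\<close> with \<open>u\<close>, \<open>w\<close>
  going to \<open>x\<close>, \<open>y\<close>. Any other edge avoids the free vertices of
  \<open>F\<close> and, being rainbow under \<open>\<chi>\<close>, contains at most one of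
  \<open>u\<close> and \<open>w\<close>. Hence its failures are bounded by all missing edges or by
  those at \<open>x\<close> or at \<open>y\<close>, and the colors of the other vertices of
  \<open>e\<close> never matter.\<close>

lemma edge_not_monochromatic_pair:
  fixes H :: "'a hgraph" and G :: "'b hgraph" and g \<delta> :: real and n :: nat
  assumes r: "r \<ge> 2" "t \<ge> r" and H: "rgraph r H" and F: "freely_critical r t H F"
    and G: "rgraph r G" "\<not> contains_copy G H" and V: "V = verts G" "card V = n" "n > 0"
    and c: "c \<in> V \<rightarrow> {1..t}" and M: "M = rainbow r V c - edges G"
    and g: "0 < g" "g \<le> 1"
    and parts: "\<And>i. i \<in> {1..t} \<Longrightarrow> real (card {x \<in> V. c x = i}) \<ge> g * real n"
    and small: "real (card (edges H) + card (verts H) ^ 2 + card (verts H)) * \<delta> < g ^ card (verts H)"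
    and rn: "real r \<le> \<delta> * real n"
    and Mn: "real (card M) \<le> \<delta> * real n ^ r"
    and x: "x \<in> V" "real (card {e \<in> M. x \<in> e}) \<le> \<delta> * real n ^ (r - 1)"
    and y: "y \<in> V" "real (card {e \<in> M. y \<in> e}) \<le> \<delta> * real n ^ (r - 1)"
    and xy: "x \<noteq> y" "c x = c y" and e: "e \<in> edges G"
  shows "\<not> {x, y} \<subseteq> e"
proof
  assume xye: "{x, y} \<subseteq> e"
  have finV: "finite V" using G V by (auto simp: rgraph_def)
  have eV: "e \<subseteq> V" "finite e" "card e = r" using e G V by (auto simp: rgraph_def nsets_def)
  have finM: "finite M" using finite_rainbow[OF finV] M by blast
  obtain \<chi> u w where uw: "u \<noteq> w" "F - free_vertices H F = {u, w}"
    and \<chi>: "\<chi> \<in> verts H \<rightarrow> {1..t}" and ic: "\<And>e. e \<in> edges H \<Longrightarrow> e \<noteq> F \<Longrightarrow> inj_on \<chi> e"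
    and \<chi>uw: "\<chi> u = c x" "\<chi> w = c x"
    by (rule freely_critical_coloring[OF r H F Pi_mem[OF c x(1)]]) blast
  have FH: "F \<in> edges H" using F by (auto simp: freely_critical_def critical_edge_def)
  have finH: "finite (verts H)" "finite (edges H)"
    using H finite_imp_finite_nsets finite_subset by (auto simp: rgraph_def)
  have Fv: "F \<subseteq> verts H" "finite F" "card F = r"
    using FH H by (auto simp: rgraph_def nsets_def)
  have uwF: "u \<in> F" "w \<in> F" using uw by auto
  define Z where "Z = verts H - F"
  have "card (F - {u, w}) = card (e - {x, y})"
    using uwF uw(1) xye xy eV Fv by (simp add: card_Diff_subset)
  then obtain q where q: "bij_betw q (F - {u, w}) (e - {x, y})"
    using Fv eV by (metis bij_betw_iff_card finite_Diff)
  \<comment> \<open>The bijection \<open>q\<close> on the free vertices is arbitrary: no edge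
    besides \<open>F\<close> sees them.\<close>
  define p where "p = (\<lambda>z. if z = u then x else if z = w then y else q z)"
  have pF: "p ` F = e"
  proof -
    have "F = (F - {u, w}) \<union> {u, w}" using uwF by blast
    then have "p ` F = p ` (F - {u, w}) \<union> p ` {u, w}" by (metis image_Un)
    also have "p ` (F - {u, w}) = q ` (F - {u, w})" by (auto simp: p_def)
    also have "\<dots> = e - {x, y}" using q by (simp add: bij_betw_def)
    also have "p ` {u, w} = {x, y}" using uw by (auto simp: p_def)
    finally show ?thesis using xye by blast
  qed
  have pinj: "inj_on p F" using pF Fv eV by (simp add: eq_card_imp_inj_on)
  define ext where "ext h z = (if z \<in> F then p z else h z)" for h :: "'a \<Rightarrow> 'b" and z
  \<comment> \<open>Placements with correct colors whose image is not an edge of \<open>G\<close>.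
    Correct colors make the image rainbow, so it belongs to \<open>M\<close>.\<close>
  define X where "X F' = {h \<in> PiE (F' - F) (\<lambda>_. V). (\<forall>z\<in>F' - F. c (h z) = \<chi> z) \<and> ext h ` F' \<notin> edges G}" for F'
  have ext_im: "ext h ` F' = p ` (F' \<inter> F) \<union> h ` (F' - F)" for h F'
    unfolding ext_def by auto
  have Xd: "real (card (X F')) \<le> \<delta> * real n ^ card (F' - F)" if F': "F' \<in> edges H - {F}" for F'
  proof -
    have iF': "inj_on \<chi> F'" and F'v: "F' \<subseteq> verts H" "finite F'" "card F' = r"
      using F' ic H by (auto simp: rgraph_def nsets_def)
    have sub: "F' \<inter> F \<subseteq> {u, w}"
    proof
      fix z assume z: "z \<in> F' \<inter> F"
      then have "z \<notin> free_vertices H F" using F' by (auto simp: free_vertices_def)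
      then show "z \<in> {u, w}" using z uw(2) by blast
    qed
    have colp: "c (p z) = \<chi> z" if "z \<in> F' \<inter> F" for z
      using that sub \<chi>uw xy uw(1) by (auto simp: p_def)
    have XM: "ext h ` F' \<in> M" if h: "h \<in> X F'" for h
    proof -
      have h': "h \<in> PiE (F' - F) (\<lambda>_. V)" "\<And>z. z \<in> F' - F \<Longrightarrow> c (h z) = \<chi> z" "ext h ` F' \<notin> edges G"
        using h by (auto simp: X_def)
      have "ext h ` F' \<in> rainbow r V c"
      proof (rule rainbow_image[OF _ iF' _ F'v(2,3)])
        show "c (ext h z) = \<chi> z" if "z \<in> F'" for z
          using that colp h'(2) by (auto simp: ext_def)
        have "h ` (F' - F) \<subseteq> V" using PiE_mem[OF h'(1)] by blast
        then show "ext h ` F' \<subseteq> V" unfolding ext_im using pF eV by blast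
      qed
      then show ?thesis using h'(3) M by blast
    qed
    have cX: "card (X F') \<le> card {e' \<in> M. p ` (F' \<inter> F) \<subseteq> e'}"
    proof (rule card_colored_maps_le[of _ c _ "F' - F" V \<chi> "p ` (F' \<inter> F)"])
      show "p ` (F' \<inter> F) \<union> h ` (F' - F) \<in> {e' \<in> M. p ` (F' \<inter> F) \<subseteq> e'}" if "h \<in> X F'" for h
        using XM[OF that] ext_im by auto
      show "finite {e' \<in> M. p ` (F' \<inter> F) \<subseteq> e'}" using finM by simp
      show "inj_on c e'" if "e' \<in> {e' \<in> M. p ` (F' \<inter> F) \<subseteq> e'}" for e'
        using that M by (simp add: rainbow_def)
      show "X F' \<subseteq> PiE (F' - F) (\<lambda>_. V)" unfolding X_def by blast
      show "c (h z) = \<chi> z" if "h \<in> X F'" "z \<in> F' - F" for h z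
        using that unfolding X_def by blast
    qed
    have not_both: "\<not> {u, w} \<subseteq> F'"
    proof
      assume "{u, w} \<subseteq> F'"
      then have "u \<in> F'" "w \<in> F'" by simp_all
      then have "u = w" using \<chi>uw by (intro inj_onD[OF iF']) simp_all
      then show False using uw(1) by simp
    qed
    \<comment> \<open>With \<open>F'\<close> disjoint from \<open>F\<close> there are
      \<open>r\<close> vertices to choose and the size of \<open>M\<close> is used; otherwise
      \<open>r - 1\<close> are left, and the degree of \<open>x\<close> or \<open>y\<close> in
      \<open>M\<close> is used.\<close>
    consider "F' \<inter> F = {}" | "F' \<inter> F = {u}" | "F' \<inter> F = {w}" using sub not_both by blast
    then show ?thesis
    proof cases
      case 1
      then have "F' - F = F'" by blast
      then show ?thesis using cX 1 F'v Mn by simp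
    next
      case 2
      then have "F' - F = F' - {u}" "u \<in> F'" by blast+
      then have "card (F' - F) = r - 1" using F'v by simp
      moreover have "real (card (X F')) \<le> real (card {e' \<in> M. x \<in> e'})"
        using cX 2 by (simp add: p_def)
      ultimately show ?thesis using x(2) by simp
    next
      case 3
      then have "F' - F = F' - {w}" "w \<in> F'" by blast+
      then have "card (F' - F) = r - 1" using F'v by simp
      moreover have "real (card (X F')) \<le> real (card {e' \<in> M. y \<in> e'})"
        using cX 3 uw(1) by (simp add: p_def)
      ultimately show ?thesis using y(2) by simp
    qed
  qed
  let ?A = "\<lambda>J. {h \<in> PiE J (\<lambda>_. V). \<forall>z\<in>J. c (h z) = \<chi> z}"
  have "\<delta> * real n > 0" using rn r by linarith
  then have \<delta>: "\<delta> > 0" using V(3) by (simp add: zero_less_mult_iff)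
  have finZ: "finite Z" using finH by (simp add: Z_def)
  have ZH: "card Z \<le> card (verts H)" unfolding Z_def using finH by (intro card_mono) auto
  have cK: "card (edges H - {F}) + card Z ^ 2 + card Z \<le> card (edges H) + card (verts H) ^ 2 + card (verts H)"
    using ZH finH by (intro add_mono power_mono card_Diff1_le) auto
  have "real (card (edges H - {F}) + card Z ^ 2 + card Z) * \<delta>
    \<le> real (card (edges H) + card (verts H) ^ 2 + card (verts H)) * \<delta>"
    using of_nat_mono[OF cK, where ?'a = real] \<delta> by (intro mult_right_mono) simp_all
  also have "\<dots> < g ^ card (verts H)" by (rule small)
  also have "\<dots> \<le> g ^ card Z" using g ZH by (intro power_decreasing) auto
  finally have small': "real (card (edges H - {F}) + card Z ^ 2 + card Z) * \<delta> < g ^ card ((\<lambda>z. {z}) ` Z)"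
    by (simp add: card_image)
  obtain f where f: "f \<in> PiE Z (\<lambda>_. V)" "\<And>J. J \<in> (\<lambda>z. {z}) ` Z \<Longrightarrow> restrict f J \<in> ?A J"
    "\<And>F'. F' \<in> edges H - {F} \<Longrightarrow> restrict f (F' - F) \<notin> X F'" "inj_on f Z" "f ` Z \<inter> e = {}"
  proof (rule exists_injective_avoiding[where U = Z and V = V and n = n and P = "(\<lambda>z. {z}) ` Z"
      and A = ?A and g = g and K = "edges H - {F}" and D = "\<lambda>F'. F' - F" and X = X and \<delta> = \<delta> and W = e])
    show "g * real n ^ card J \<le> real (card (?A J))" if J: "J \<in> (\<lambda>z. {z}) ` Z" for J
    proof -
      obtain z where z: "z \<in> Z" "J = {z}" using J by blast
      then have "\<chi> z \<in> {1..t}" using Pi_mem[OF \<chi>, of z] by (simp add: Z_def)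
      then show ?thesis using parts[of "\<chi> z"] z card_color_class[of z V c "\<chi> z"] by simp
    qed
    show "F' - F \<subseteq> Z" if "F' \<in> edges H - {F}" for F'
      using that H by (auto simp: Z_def rgraph_def nsets_def)
    show "X F' \<subseteq> PiE (F' - F) (\<lambda>_. V)" for F' by (auto simp: X_def)
    show "real (card e) \<le> \<delta> * real n" using rn eV by simp
    show "1 \<le> \<delta> * real n" using rn r by linarith
    show "finite (edges H - {F})" using finH by simp
  qed (use finZ finV V(2,3) g(1) Xd eV(2) small' that disjoint_singletons in \<open>blast+\<close>)
  have fV: "f ` Z \<subseteq> V" using PiE_mem[OF f(1)] by blast
  have fcol: "c (f z) = \<chi> z" if "z \<in> Z" for z using f(2)[of "{z}"] that by auto
  have "ext f ` verts H \<subseteq> V"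
  proof -
    have "verts H = F \<union> Z" using Fv by (auto simp: Z_def)
    then have "ext f ` verts H = p ` F \<union> f ` Z" by (auto simp: ext_def Z_def)
    then show ?thesis using pF eV fV by blast
  qed
  moreover have "inj_on (ext f) (verts H)"
  proof -
    have "inj_on (ext f) F" using pinj by (simp add: ext_def inj_on_def)
    moreover have "inj_on (ext f) Z" using f(4) by (simp add: ext_def inj_on_def Z_def)
    moreover have "ext f ` F = e" using pF by (simp add: ext_def)
    moreover have "ext f ` Z = f ` Z" by (simp add: ext_def Z_def)
    ultimately have "inj_on (ext f) (F \<union> Z)" using f(5) unfolding inj_on_Un by blast
    moreover have "verts H = F \<union> Z" using Fv by (auto simp: Z_def)
    ultimately show ?thesis by simp
  qed
  moreover have "ext f ` F' \<in> edges G" if F': "F' \<in> edges H" for F'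
  proof (cases "F' = F")
    case True
    then show ?thesis using pF e by (simp add: ext_def)
  next
    case False
    have F'Z: "F' - F \<subseteq> Z" using F' H by (auto simp: Z_def rgraph_def nsets_def)
    have im: "ext (restrict f (F' - F)) ` F' = ext f ` F'"
      by (rule image_cong) (auto simp: ext_def)
    have "restrict f (F' - F) \<in> PiE (F' - F) (\<lambda>_. V)"
      using F'Z fV by (auto simp: restrict_PiE_iff)
    moreover have "\<forall>z\<in>F' - F. c (restrict f (F' - F) z) = \<chi> z" using fcol F'Z by auto
    ultimately show ?thesis using f(3)[of F'] F' False im unfolding X_def by auto
  qed
  ultimately have "contains_copy G H" unfolding contains_copy_def V(1) by blast
  then show False using G(2) by simp
qed

text \<open>The bijection shows that \<open>\<Union>S\<close> has \<open>t - 1\<close> elements, so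
  it misses exactly one color \<open>i\<close>; comparing cardinalities, \<open>S\<close> contains
  every \<open>k\<close>-set avoiding \<open>i\<close>.\<close>

lemma isomorphic_complete:
  assumes iso: "isomorphic (\<Union>S, S) (complete_hgraph k m)" and S: "S \<subseteq> nsets {1..t} k" and t: "t = Suc m"
  shows "\<exists>i\<in>{1..t}. S = nsets ({1..t} - {i}) k"
proof -
  obtain f where f: "bij_betw f (\<Union>S) {1..m}" and E: "nsets {1..m} k = (\<lambda>e. f ` e) ` S"
    using iso by (auto simp: isomorphic_def complete_hgraph_def)
  have US: "\<Union>S \<subseteq> {1..t}" using S by (auto simp: nsets_def)
  have "card (\<Union>S) = m" using bij_betw_same_card[OF f] by simp
  then have "card ({1..t} - \<Union>S) = 1" using US t by (simp add: card_Diff_subset finite_subset)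
  then obtain i where i: "{1..t} - \<Union>S = {i}" by (auto simp: card_1_singleton_iff)
  then have Ui: "\<Union>S = {1..t} - {i}" and it: "i \<in> {1..t}" using US by blast+
  have "S \<subseteq> nsets ({1..t} - {i}) k" using S Ui by (auto simp: nsets_def)
  moreover have "card S = card (nsets ({1..t} - {i}) k)"
  proof -
    have "inj_on (\<lambda>e. f ` e) S"
      using f by (intro inj_on_subset[OF inj_on_image_Pow[of f "\<Union>S"]]) (auto simp: bij_betw_def)
    then have "card S = card (nsets {1..m} k)" using E by (simp add: card_image)
    then show ?thesis using it t by simp
  qed
  ultimately have "S = nsets ({1..t} - {i}) k"
    by (intro card_subset_eq finite_imp_finite_nsets) auto
  then show ?thesis using it by blast
qed

lemma link_types:
  fixes H :: "'a hgraph" and G :: "'b hgraph" and g \<delta> :: real and n :: nat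
  assumes r: "r \<ge> 2" "t \<ge> r" and H: "rgraph r H" and spike: "spike r t H F v"
    and G: "rgraph r G" "\<not> contains_copy G H" and V: "V = verts G" "card V = n" "n > 0"
    and M: "M = rainbow r V c - edges G"
    and g: "0 < g" "g \<le> 1"
    and parts: "\<And>i. i \<in> {1..t} \<Longrightarrow> real (card {x \<in> V. c x = i}) \<ge> g * real n"
    and small: "real (card (edges H) + card (verts H) ^ 2 + card (verts H)) * \<delta> < g ^ card (verts H)"
    and rn: "1 \<le> \<delta> * real n"
    and Mn: "real (card M) \<le> \<delta> * real n ^ r"
    and x: "x \<in> V"
    and S: "S = {T \<in> nsets {1..t} (r - 1). real (card {I \<in> link r G x. c ` I = T}) \<ge> g * real n ^ (r - 1)}"
    and Sc: "card S \<ge> (t - 1) choose (r - 1)"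
  shows "\<exists>i\<in>{1..t}. S = nsets ({1..t} - {i}) (r - 1)"
proof (rule ccontr)
  assume no: "\<not> (\<exists>i\<in>{1..t}. S = nsets ({1..t} - {i}) (r - 1))"
  have St: "S \<subseteq> nsets {1..t} (r - 1)" using S by blast
  have niso: "\<not> isomorphic (\<Union>S, S) (complete_hgraph (r - 1) (t - 1))"
    using isomorphic_complete[OF _ St, of "t - 1"] no r by auto
  note sp = spike[unfolded spike_def]
  have vF: "v \<in> F" "F \<in> edges H" and matching: "pairwise disjnt (link r H v)"
    using sp by simp_all
  have "\<exists>\<phi>\<in>verts H \<rightarrow> {1..t}.
      (\<forall>F'\<in>edges H. v \<notin> F' \<longrightarrow> card (\<phi> ` F') = r) \<and>
      (\<forall>I\<in>link r H v. card (\<phi> ` I) = r - 1 \<and> \<phi> ` I \<in> S)"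
    using sp[THEN conjunct2, THEN conjunct2, THEN conjunct2, THEN conjunct2, THEN conjunct2,
      THEN spec[of _ S], THEN mp] St Sc niso by simp
  then obtain \<phi> where "\<phi> \<in> verts H \<rightarrow> {1..t} \<and>
      (\<forall>F'\<in>edges H. v \<notin> F' \<longrightarrow> card (\<phi> ` F') = r) \<and>
      (\<forall>I\<in>link r H v. card (\<phi> ` I) = r - 1 \<and> \<phi> ` I \<in> S)" unfolding Bex_def ..
  then have \<phi>: "\<phi> \<in> verts H \<rightarrow> {1..t}"
    and \<phi>e: "\<And>F'. F' \<in> edges H \<Longrightarrow> v \<notin> F' \<Longrightarrow> card (\<phi> ` F') = r"
    and \<phi>I: "\<And>I. I \<in> link r H v \<Longrightarrow> card (\<phi> ` I) = r - 1 \<and> \<phi> ` I \<in> S"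
    by simp_all
  have finV: "finite V" using G V by (auto simp: rgraph_def)
  have finM: "finite M" using finite_rainbow[OF finV] M by blast
  have finH: "finite (verts H)" "finite (edges H)"
    using H finite_imp_finite_nsets finite_subset by (auto simp: rgraph_def)
  have Hv: "F' \<subseteq> verts H" "finite F'" "card F' = r" if "F' \<in> edges H" for F'
    using that H by (auto simp: rgraph_def nsets_def)
  have vH: "v \<in> verts H" using vF Hv by blast
  define Z where "Z = verts H - {v}"
  have finZ: "finite Z" using finH by (simp add: Z_def)
  have ZH: "card Z \<le> card (verts H)" unfolding Z_def using finH by (intro card_mono) auto
  let ?L = "link r H v"
  have Lr: "I \<in> ?L \<longleftrightarrow> v \<notin> I \<and> insert v I \<in> edges H" for I
    by (rule link_rgraph[OF H r(1)])
  have L: "I \<subseteq> Z" "finite I" "card I = r - 1" if "I \<in> ?L" for I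
    using that Lr[of I] Hv[of "insert v I"] by (auto simp: Z_def link_def)
  have LG: "I \<subseteq> V" "card I = r - 1" "finite I" if "I \<in> link r G x" for I
  proof -
    have "insert x I \<in> nsets V r" using that G(1) V(1) unfolding link_def rgraph_def by blast
    then show "I \<subseteq> V" "card I = r - 1" "finite I"
      using that unfolding link_def nsets_def by simp_all
  qed
  \<comment> \<open>The link sets of \<open>v\<close> are blocks because their vertices are chosen
    jointly; their disjointness makes this a partition, completed by singletons.\<close>
  define P where "P = ?L \<union> (\<lambda>z. {z}) ` (Z - \<Union>?L)"
  have PU: "\<Union>P = Z" using L(1) unfolding P_def by blast
  have Pd: "pairwise disjnt P"
    using matching unfolding P_def pairwise_def disjnt_def by blast
  have Pe: "{} \<notin> P" using L(3)[of "{}"] r unfolding P_def by auto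
  \<comment> \<open>Blocks are nonempty, so there are at most \<open>card Z\<close> of them and the
    exponent \<open>card (verts H)\<close> in the smallness condition suffices for
    \<open>g ^ card P\<close>.\<close>
  have cP: "card P \<le> card Z"
  proof -
    have fJ: "finite J" "card J \<ge> 1" if "J \<in> P" for J
    proof -
      show "finite J" using that PU finZ by (metis Sup_upper finite_subset)
      then show "card J \<ge> 1" using that Pe by (cases "J = {}") (auto simp: Suc_le_eq card_gt_0_iff)
    qed
    have "card P = (\<Sum>J\<in>P. 1)" by simp
    also have "\<dots> \<le> (\<Sum>J\<in>P. card J)" using fJ by (intro sum_mono) auto
    also have "\<dots> = card Z" using card_Union_disjoint[OF Pd] fJ PU by simp
    finally show ?thesis .
  qed
  let ?A = "\<lambda>J. {h \<in> PiE J (\<lambda>_. V). (\<forall>z\<in>J. c (h z) = \<phi> z) \<and> (J \<in> ?L \<longrightarrow> h ` J \<in> link r G x)}"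
  have Ag: "g * real n ^ card J \<le> real (card (?A J))" if J: "J \<in> P" for J
  proof (cases "J \<in> ?L")
    case True
    have inj: "inj_on \<phi> J" using \<phi>I[OF True] L[OF True] by (intro eq_card_imp_inj_on) auto
    let ?LJ = "{I \<in> link r G x. c ` I = \<phi> ` J}"
    have "g * real n ^ card J \<le> real (card ?LJ)" using \<phi>I[OF True] S L[OF True] by simp
    also have "card ?LJ \<le> card {h \<in> PiE J (\<lambda>_. V). (\<forall>z\<in>J. c (h z) = \<phi> z) \<and> h ` J \<in> ?LJ}"
    proof (rule card_colored_maps_ge[OF finV L(2)[OF True] _ inj])
      fix I assume I: "I \<in> ?LJ"
      then have "card (c ` I) = card I" using \<phi>I[OF True] LG(2)[of I] by simp
      then show "I \<subseteq> V \<and> inj_on c I \<and> c ` I = \<phi> ` J"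
        using I LG[of I] by (auto intro: eq_card_imp_inj_on)
    qed
    also have "\<dots> \<le> card (?A J)"
      by (intro card_mono) (use finV L(2)[OF True] finite_PiE[of J "\<lambda>_. V"] in auto)
    finally show ?thesis by simp
  next
    case False
    then obtain z where z: "z \<in> Z" "J = {z}" using J P_def by blast
    then have "\<phi> z \<in> {1..t}" using Pi_mem[OF \<phi>, of z] by (simp add: Z_def)
    moreover have "?A J = {h \<in> PiE {z} (\<lambda>_. V). c (h z) = \<phi> z}" using z False by auto
    ultimately show ?thesis using parts[of "\<phi> z"] z card_color_class[of z V c "\<phi> z"] by simp
  qed
  define K where "K = {F' \<in> edges H. v \<notin> F'}"
  define X where "X F' = {h \<in> PiE F' (\<lambda>_. V). (\<forall>z\<in>F'. c (h z) = \<phi> z) \<and> h ` F' \<notin> edges G}" for F'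
  have finK: "finite K" using finH by (simp add: K_def)
  have Xd: "real (card (X F')) \<le> \<delta> * real n ^ card F'" if F': "F' \<in> K" for F'
  proof -
    have F'H: "F' \<in> edges H" "v \<notin> F'" using F' by (auto simp: K_def)
    have inj: "inj_on \<phi> F'" using \<phi>e[OF F'H] Hv[OF F'H(1)] by (intro eq_card_imp_inj_on) auto
    have "card (X F') \<le> card M"
    proof (rule card_colored_maps_le[OF finM, of c _ F' V \<phi> "{}"])
      show "inj_on c e" if "e \<in> M" for e using that M by (simp add: rainbow_def)
      show "X F' \<subseteq> PiE F' (\<lambda>_. V)" unfolding X_def by blast
      show "c (h z) = \<phi> z" if "h \<in> X F'" "z \<in> F'" for h z using that unfolding X_def by blast
      show "{} \<union> h ` F' \<in> M" if h: "h \<in> X F'" for h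
      proof -
        have h': "h \<in> PiE F' (\<lambda>_. V)" "\<And>z. z \<in> F' \<Longrightarrow> c (h z) = \<phi> z" "h ` F' \<notin> edges G"
          using h by (auto simp: X_def)
        have "h ` F' \<subseteq> V" using PiE_mem[OF h'(1)] by blast
        then have "h ` F' \<in> rainbow r V c"
          by (intro rainbow_image[of F' c h \<phi> V r]) (use h'(2) inj Hv[OF F'H(1)] in auto)
        then show ?thesis using h'(3) M by simp
      qed
    qed
    then show ?thesis using Mn Hv[OF F'H(1)] by simp
  qed
  have "\<delta> * real n > 0" using rn by linarith
  then have \<delta>: "\<delta> > 0" using V(3) by (simp add: zero_less_mult_iff)
  have "card K \<le> card (edges H)" unfolding K_def using finH by (intro card_mono) auto
  then have cK: "card K + card Z ^ 2 + card Z \<le> card (edges H) + card (verts H) ^ 2 + card (verts H)"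
    using ZH by (intro add_mono power_mono) auto
  have "real (card K + card Z ^ 2 + card Z) * \<delta>
    \<le> real (card (edges H) + card (verts H) ^ 2 + card (verts H)) * \<delta>"
    using of_nat_mono[OF cK, where ?'a = real] \<delta> by (intro mult_right_mono) simp_all
  also have "\<dots> < g ^ card (verts H)" by (rule small)
  also have "\<dots> \<le> g ^ card P" using g ZH cP by (intro power_decreasing) auto
  finally have small': "real (card K + card Z ^ 2 + card Z) * \<delta> < g ^ card P" .
  obtain f where f: "f \<in> PiE Z (\<lambda>_. V)" "\<And>J. J \<in> P \<Longrightarrow> restrict f J \<in> ?A J"
    "\<And>F'. F' \<in> K \<Longrightarrow> restrict f F' \<notin> X F'" "inj_on f Z" "f ` Z \<inter> {x} = {}"
  proof (rule exists_injective_avoiding[where U = Z and V = V and n = n and P = P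
      and A = ?A and g = g and K = K and D = "\<lambda>F'. F'" and X = X and \<delta> = \<delta> and W = "{x}"])
    show "F' \<subseteq> Z" if "F' \<in> K" for F'
      using that Hv by (auto simp: Z_def K_def)
    show "X F' \<subseteq> PiE F' (\<lambda>_. V)" for F' by (auto simp: X_def)
    show "?A J \<subseteq> PiE J (\<lambda>_. V)" for J by blast
    show "real (card {x}) \<le> \<delta> * real n" using rn by simp
    show "finite {x}" by simp
  qed (use finZ finV V(2,3) PU Pd Pe Ag g(1) finK Xd rn small' that in \<open>blast+\<close>)
  have fV: "f ` Z \<subseteq> V" using PiE_mem[OF f(1)] by blast
  have fcol: "c (f z) = \<phi> z" if z: "z \<in> Z" for z
  proof -
    obtain J where J: "J \<in> P" "z \<in> J" using PU z by blast
    then show ?thesis using f(2)[OF J(1)] by auto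
  qed
  define f' where "f' = f(v := x)"
  have f'Z: "f' ` Y = f ` Y" if "v \<notin> Y" for Y
    by (rule image_cong) (use that in \<open>auto simp: f'_def\<close>)
  have HZ: "verts H = insert v Z" "v \<notin> Z" using vH by (auto simp: Z_def)
  have "f' ` verts H \<subseteq> V"
    unfolding HZ(1) image_insert f'Z[OF HZ(2)] using fV x by (simp add: f'_def)
  moreover have "inj_on f' (verts H)"
  proof -
    have "inj_on f' Z" using f(4) HZ(2) by (auto simp: f'_def inj_on_def)
    moreover have "f' v \<notin> f' ` Z" unfolding f'Z[OF HZ(2)] using f(5) by (simp add: f'_def)
    ultimately show ?thesis using HZ by simp
  qed
  moreover have "f' ` F' \<in> edges G" if F': "F' \<in> edges H" for F'
  proof (cases "v \<in> F'")
    case True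
    then have "F' - {v} \<in> ?L" unfolding Lr using F' by (simp add: insert_absorb)
    moreover from this have "F' - {v} \<in> P" by (simp add: P_def)
    ultimately have "restrict f (F' - {v}) ` (F' - {v}) \<in> link r G x" using f(2) by blast
    then have "f ` (F' - {v}) \<in> link r G x" by simp
    then have "insert x (f ` (F' - {v})) \<in> edges G" using link_rgraph[OF G(1) r(1)] by blast
    moreover have "f' ` F' = insert x (f ` (F' - {v}))"
    proof -
      have "f' ` insert v (F' - {v}) = insert (f' v) (f' ` (F' - {v}))" by (rule image_insert)
      then show ?thesis using True f'Z[of "F' - {v}"] by (simp add: insert_absorb f'_def)
    qed
    ultimately show ?thesis by simp
  next
    case False
    then have F'K: "F' \<in> K" "F' \<subseteq> Z" using F' Hv by (auto simp: K_def Z_def)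
    have "restrict f F' \<in> PiE F' (\<lambda>_. V)" using F'K fV by (auto simp: restrict_PiE_iff)
    moreover have "\<forall>z\<in>F'. c (restrict f F' z) = \<phi> z" using fcol F'K by auto
    ultimately have "restrict f F' ` F' \<in> edges G" using f(3)[OF F'K(1)] unfolding X_def by blast
    then show ?thesis using f'Z[OF False] by simp
  qed
  ultimately have "contains_copy G H" unfolding contains_copy_def V(1) by blast
  then show False using G(2) by simp
qed

section \<open>Nearly extremal colorings are balanced\<close>

lemma sum_color_classes:
  assumes "finite V" "finite A" "c \<in> V \<rightarrow> A"
  shows "(\<Sum>i\<in>A. card {x \<in> V. c x = i}) = card V"
proof -
  have "(\<Sum>i\<in>A. \<Sum>x\<in>{x \<in> V. c x = i}. 1) = (\<Sum>x\<in>V. 1::nat)"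
    by (rule sum.group) (use assms in auto)
  then show ?thesis by simp
qed

text \<open>Balancing two parts with difference at least \<open>2 * k\<close> gains at least
  \<open>k\<^sup>2\<close> times the number of rainbow \<open>(r-2)\<close>-sets in the other parts.
  That number is of order \<open>n ^ (r - 2)\<close>, since otherwise the blowup would have too few
  edges, while the gain is at most \<open>\<eta> * real n ^ r\<close> by near maximality. The
  summand 1 comes from halving the difference.\<close>

lemma color_class_difference_le:
  fixes V :: "nat set" and \<eta> \<gamma> \<beta> :: real
  assumes r: "r \<ge> 2" and V: "finite V" "card V = n" "n > 0" and c: "c \<in> V \<rightarrow> {1..t}"
    and m: "real (max_edges (blowups r (complete_hgraph r t)) n) = m"
    and mg: "m \<ge> \<gamma> * real n ^ r" and Bm: "real (card (rainbow r V c)) \<ge> m - \<eta> * real n ^ r"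
    and \<eta>: "\<eta> \<le> \<gamma> / 2" "0 < \<gamma>" and \<beta>: "6 * \<eta> \<le> \<gamma> * \<beta>\<^sup>2" "0 \<le> \<beta>"
    and ij: "i \<in> {1..t}" "j \<in> {1..t}" "i \<noteq> j"
  shows "real (card {x \<in> V. c x = i}) \<le> real (card {x \<in> V. c x = j}) + 2 * \<beta> * real n + 1"
proof -
  define a where "a l = real (card {x \<in> V. c x = l})" for l
  \<comment> \<open>Truncated subtraction gives \<open>k = 0\<close> when part \<open>i\<close> is
    not the larger one. Half of the difference is moved, so that part \<open>j\<close> does not
    overtake part \<open>i\<close>.\<close>
  define k where "k = (card {x \<in> V. c x = i} - card {x \<in> V. c x = j}) div 2"
  have k_le: "k \<le> card {x \<in> V. c x = i}" by (simp add: k_def)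
  obtain W where W: "W \<subseteq> {x \<in> V. c x = i}" "card W = k" "finite W"
    using obtain_subset_with_card_n[OF k_le] by blast
  \<comment> \<open>Moving \<open>k\<close> vertices from part \<open>i\<close> to part \<open>j\<close> gains at least \<open>k\<^sup>2 * E q\<close> edges.\<close>
  define c' where "c' x = (if x \<in> W then j else c x)" for x
  define a' where "a' l = real (card {x \<in> V. c' x = l})" for l
  have c': "c' \<in> V \<rightarrow> {1..t}" using Pi_mem[OF c] ij by (auto simp: c'_def simp del: atLeastAtMost_iff)
  have "{x \<in> V. c' x = i} = {x \<in> V. c x = i} - W" using W(1) ij(3) by (auto simp: c'_def)
  then have a'i: "a' i = a i - real k"
    unfolding a'_def a_def using W V k_le by (simp add: card_Diff_subset of_nat_diff)
  have "{x \<in> V. c' x = j} = {x \<in> V. c x = j} \<union> W" "{x \<in> V. c x = j} \<inter> W = {}"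
    using W(1) ij(3) by (auto simp: c'_def)
  then have a'j: "a' j = a j + real k"
    unfolding a'_def a_def using W V by (simp add: card_Un_disjoint)
  define R where "R = {1..t} - {i, j}"
  have R: "finite R" "i \<notin> R" "j \<notin> R" "insert i (insert j R) = {1..t}"
    using ij by (auto simp: R_def)
  have a'R: "a' l = a l" if "l \<in> R" for l
  proof -
    have "{x \<in> V. c' x = l} = {x \<in> V. c x = l}" using W(1) that by (auto simp: c'_def R_def)
    then show ?thesis by (simp add: a_def a'_def)
  qed
  define q where "q = r - 2"
  have rq: "r = Suc (Suc q)" using r by (simp add: q_def)
  \<comment> \<open>\<open>E p\<close> counts the rainbow \<open>p\<close>-sets avoiding the parts
    \<open>i\<close> and \<open>j\<close>, which the recoloring of \<open>W\<close> leaves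
    unchanged.\<close>
  define E where "E p = esym p R a" for p
  have a0: "a l \<ge> 0" for l by (simp add: a_def)
  have E0: "E p \<ge> 0" for p unfolding E_def by (rule esym_nonneg) (simp add: a0)
  have B: "real (card (rainbow r V c)) = E r + (a i + a j) * E (Suc q) + a i * a j * E q"
    unfolding card_rainbow[OF V(1) finite_atLeastAtMost c] a_def[symmetric] rq R(4)[symmetric]
      esym_two_insert[OF R(2,3) ij(3) R(1)] E_def ..
  have "real (card (rainbow r V c')) = E r + (a' i + a' j) * E (Suc q) + a' i * a' j * E q"
    unfolding card_rainbow[OF V(1) finite_atLeastAtMost c'] a'_def[symmetric] rq R(4)[symmetric]
      esym_two_insert[OF R(2,3) ij(3) R(1)] E_def using a'R esym_cong[of R a' a] by simp
  then have B': "real (card (rainbow r V c')) = E r + (a i + a j) * E (Suc q) + (a i - real k) * (a j + real k) * E q"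
    using a'i a'j by simp
  have le_m: "real (card (rainbow r V c')) \<le> m"
    using card_rainbow_le_max_edges[OF r V(1) c'] V(2) m by simp
  have sumR: "sum a R + a i + a j = real n"
  proof -
    have "sum a {1..t} = real n"
      using sum_color_classes[OF V(1) finite_atLeastAtMost c] V(2) unfolding a_def by (metis of_nat_sum)
    then show ?thesis using R ij(3) by (metis (no_types, lifting) add.assoc add.commute finite_insert insert_iff sum.insert)
  qed
  have sR: "sum a R \<ge> 0" by (simp add: sum_nonneg a0)
  have E1: "E (Suc q) \<le> E q * real n"
  proof -
    have "E (Suc q) \<le> E q * sum a R" unfolding E_def by (rule esym_Suc_le) (use R a0 in auto)
    also have "\<dots> \<le> E q * real n" using sumR a0[of i] a0[of j] E0 by (intro mult_left_mono) linarith+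
    finally show ?thesis .
  qed
  have E2: "E r \<le> E q * real n * real n"
  proof -
    have "E r \<le> E (Suc q) * sum a R" unfolding E_def rq by (rule esym_Suc_le) (use R a0 in auto)
    also have "\<dots> \<le> E (Suc q) * real n" using sumR a0[of i] a0[of j] E0 by (intro mult_left_mono) linarith+
    also have "\<dots> \<le> E q * real n * real n" using E1 by (intro mult_right_mono) auto
    finally show ?thesis .
  qed
  have an: "a i + a j \<le> real n" "a i \<le> real n" "a j \<le> real n" using sumR sR a0[of i] a0[of j] by linarith+
  \<comment> \<open>Each of the three summands of the edge count is at most
    \<open>n\<^sup>2 * E q\<close>. With the lower bound below this forces \<open>E q\<close> to be
    large, and it yields the factor 6 in the condition on \<open>\<beta>\<close>.\<close>
  have "real (card (rainbow r V c)) \<le> 3 * (E q * real n * real n)"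
  proof -
    have "(a i + a j) * E (Suc q) \<le> real n * (E q * real n)"
      using an E1 E0 a0 by (intro mult_mono) auto
    moreover have "a i * a j * E q \<le> real n * real n * E q"
      using an a0 E0 by (intro mult_mono) auto
    ultimately show ?thesis using B E2 by (simp add: algebra_simps)
  qed
  moreover have "real (card (rainbow r V c)) \<ge> \<gamma> / 2 * real n ^ r"
  proof -
    have "\<eta> * real n ^ r \<le> \<gamma> / 2 * real n ^ r" using \<eta> by (intro mult_right_mono) auto
    then show ?thesis using Bm mg by (simp add: algebra_simps)
  qed
  ultimately have Eq: "\<gamma> / 2 * real n ^ r \<le> 3 * (real n)\<^sup>2 * E q"
    by (simp add: power2_eq_square algebra_simps)
  have gain: "(real k)\<^sup>2 * E q \<le> \<eta> * real n ^ r"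
  proof (cases "k = 0")
    case True
    have "\<eta> * real n ^ r \<ge> 0"
      using Bm card_rainbow_le_max_edges[OF r V(1) c] V(2) m by simp
    then show ?thesis using True by simp
  next
    case False
    have "2 * k \<le> card {x \<in> V. c x = i} - card {x \<in> V. c x = j}" by (simp add: k_def)
    then have "card {x \<in> V. c x = j} + 2 * k \<le> card {x \<in> V. c x = i}" using False by linarith
    then have "a i - a j - real k \<ge> real k" unfolding a_def by linarith
    then have "real k * (real k * E q) \<le> real k * ((a i - a j - real k) * E q)"
      using E0 by (intro mult_left_mono mult_right_mono) auto
    also have "\<dots> = real (card (rainbow r V c')) - real (card (rainbow r V c))"
      unfolding B B' by (simp add: algebra_simps)
    also have "\<dots> \<le> \<eta> * real n ^ r" using le_m Bm by linarith
    finally show ?thesis by (simp add: power2_eq_square algebra_simps)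
  qed
  have "(real k)\<^sup>2 * (\<gamma> / 2 * real n ^ r) \<le> (real k)\<^sup>2 * (3 * (real n)\<^sup>2 * E q)"
    using Eq by (intro mult_left_mono) auto
  also have "\<dots> = 3 * (real n)\<^sup>2 * ((real k)\<^sup>2 * E q)" by simp
  also have "\<dots> \<le> 3 * (real n)\<^sup>2 * (\<eta> * real n ^ r)" using gain by (intro mult_left_mono) auto
  finally have "(real k)\<^sup>2 * \<gamma> * real n ^ r \<le> 6 * \<eta> * (real n)\<^sup>2 * real n ^ r" by (simp add: algebra_simps)
  then have "(real k)\<^sup>2 * \<gamma> \<le> 6 * \<eta> * (real n)\<^sup>2" using V(3) by simp
  also have "\<dots> \<le> \<gamma> * \<beta>\<^sup>2 * (real n)\<^sup>2" using \<beta> by (intro mult_right_mono) auto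
  finally have "\<gamma> * (real k)\<^sup>2 \<le> \<gamma> * (\<beta> * real n)\<^sup>2"
    by (simp only: power_mult_distrib mult.assoc mult.commute[of _ \<gamma>])
  then have "(real k)\<^sup>2 \<le> (\<beta> * real n)\<^sup>2" using \<eta>(2) by (simp only: mult_le_cancel_left_pos)
  then have "real k \<le> \<beta> * real n"
    by (rule power2_le_imp_le) (use \<beta>(2) in simp)
  moreover have "a i \<le> a j + 2 * real k + 1"
  proof -
    have "card {x \<in> V. c x = i} \<le> card {x \<in> V. c x = j} + 2 * k + 1" unfolding k_def by linarith
    then show ?thesis unfolding a_def by linarith
  qed
  ultimately show ?thesis unfolding a_def by linarith
qed

text \<open>The mean part size is \<open>n / t\<close>, so averaging the pairwise bounds over the
  other part gives both inequalities.\<close>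

lemma color_classes_balanced:
  fixes V :: "nat set" and \<eta> \<gamma> \<beta> :: real
  assumes r: "r \<ge> 2" and V: "finite V" "card V = n" "n > 0" and c: "c \<in> V \<rightarrow> {1..t}"
    and m: "real (max_edges (blowups r (complete_hgraph r t)) n) = m"
    and mg: "m \<ge> \<gamma> * real n ^ r" and Bm: "real (card (rainbow r V c)) \<ge> m - \<eta> * real n ^ r"
    and \<eta>: "\<eta> \<le> \<gamma> / 2" "0 < \<gamma>" and \<beta>: "6 * \<eta> \<le> \<gamma> * \<beta>\<^sup>2" "0 \<le> \<beta>"
    and i: "i \<in> {1..t}"
  shows "\<bar>real (card {x \<in> V. c x = i}) - real n / real t\<bar> \<le> 2 * \<beta> * real n + 1"
proof -
  define a where "a l = real (card {x \<in> V. c x = l})" for l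
  define d where "d = 2 * \<beta> * real n + 1"
  have d0: "d \<ge> 0" using \<beta> by (simp add: d_def)
  have diff: "a i \<le> a j + d" if "i \<in> {1..t}" "j \<in> {1..t}" for i j
    using color_class_difference_le[OF r V c m mg Bm \<eta> \<beta> that] d0
    by (cases "i = j") (simp_all add: a_def d_def)
  have s: "sum a {1..t} = real n"
    using sum_color_classes[OF V(1) finite_atLeastAtMost c] V(2) unfolding a_def by (metis of_nat_sum)
  have t0: "real t > 0" using i by auto
  have "real t * a i = (\<Sum>j\<in>{1..t}. a i)" by simp
  also have "\<dots> \<le> (\<Sum>j\<in>{1..t}. a j + d)" using diff i by (intro sum_mono) blast
  also have "\<dots> = real n + real t * d" using s by (simp add: sum.distrib)
  finally have "a i \<le> real n / real t + d" using t0 by (simp add: field_simps)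
  moreover have "real n = (\<Sum>j\<in>{1..t}. a j)" using s by simp
  then have "real n \<le> (\<Sum>j\<in>{1..t}. a i + d)" using diff[OF _ i] by (simp only:) (intro sum_mono, blast)
  then have "real n \<le> real t * (a i + d)" by simp
  then have "real n / real t - d \<le> a i" using t0 by (simp add: field_simps)
  ultimately show ?thesis unfolding a_def d_def by linarith
qed

section \<open>Degrees and optimal colorings\<close>

lemma sum_degrees:
  assumes V: "finite V" and E: "E \<subseteq> nsets V r"
  shows "(\<Sum>x\<in>V. card {e \<in> E. x \<in> e}) = r * card E"
proof -
  have finE: "finite E" using E V finite_imp_finite_nsets finite_subset by blast
  have "(\<Sum>x\<in>V. card {e \<in> E. x \<in> e}) = (\<Sum>x\<in>V. \<Sum>e\<in>E. if x \<in> e then 1 else 0)"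
    using finE by (simp add: sum.If_cases Int_def)
  also have "\<dots> = (\<Sum>e\<in>E. \<Sum>x\<in>V. if x \<in> e then 1 else 0)" by (rule sum.swap)
  also have "\<dots> = (\<Sum>e\<in>E. r)"
  proof (rule sum.cong[OF refl])
    fix e assume "e \<in> E"
    then have e: "e \<subseteq> V" "card e = r" using E by (auto simp: nsets_def)
    then have "V \<inter> {x. x \<in> e} = e" by blast
    then show "(\<Sum>x\<in>V. if x \<in> e then 1 else 0) = r" using V e by (simp add: sum.If_cases)
  qed
  finally show ?thesis by simp
qed

lemma card_containing:
  assumes "x \<notin> \<Union>L" "\<And>e. x \<in> e \<Longrightarrow> e \<in> E \<longleftrightarrow> e - {x} \<in> L"
  shows "card {e \<in> E. x \<in> e} = card L"
proof (rule bij_betw_same_card[of "\<lambda>e. e - {x}"])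
  show "bij_betw (\<lambda>e. e - {x}) {e \<in> E. x \<in> e} L"
  proof (rule bij_betwI[where g = "insert x"])
    show "(\<lambda>e. e - {x}) \<in> {e \<in> E. x \<in> e} \<rightarrow> L" using assms(2) by auto
    show "insert x \<in> L \<rightarrow> {e \<in> E. x \<in> e}"
    proof
      fix I assume I: "I \<in> L"
      then have "insert x I - {x} = I" using assms(1) by auto
      then show "insert x I \<in> {e \<in> E. x \<in> e}" using assms(2)[of "insert x I"] I by simp
    qed
    show "insert x (e - {x}) = e" if "e \<in> {e \<in> E. x \<in> e}" for e using that by auto
    show "insert x I - {x} = I" if "I \<in> L" for I using that assms(1) by auto
  qed
qed

lemma card_link:
  assumes "rgraph r G" "r \<ge> 2"
  shows "card (link r G x) = card {e \<in> edges G. x \<in> e}"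
proof (rule card_containing[symmetric])
  show "x \<notin> \<Union>(link r G x)" using link_rgraph[OF assms] by blast
  show "e \<in> edges G \<longleftrightarrow> e - {x} \<in> link r G x" if "x \<in> e" for e
    unfolding link_rgraph[OF assms] using that by (simp add: insert_absorb)
qed

text \<open>Markov's inequality for the degrees in \<open>M\<close>, whose sum is
  \<open>r * card M\<close>. It bounds the number of bad vertices.\<close>

lemma card_large_degree_le:
  fixes \<epsilon> \<delta> :: real
  assumes V: "finite V" "card V = n" "n > 0" and r: "r \<ge> 1" and M: "M \<subseteq> nsets V r"
    and Mn: "real (card M) \<le> \<epsilon> * real n ^ r"
  shows "real (card {x \<in> V. real (card {e \<in> M. x \<in> e}) > \<delta> * real n ^ (r - 1)}) * \<delta> \<le> real r * \<epsilon> * real n"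
proof -
  let ?B = "{x \<in> V. real (card {e \<in> M. x \<in> e}) > \<delta> * real n ^ (r - 1)}"
  have "real (card ?B) * (\<delta> * real n ^ (r - 1)) = (\<Sum>x\<in>?B. \<delta> * real n ^ (r - 1))" by simp
  also have "\<dots> \<le> (\<Sum>x\<in>?B. real (card {e \<in> M. x \<in> e}))" by (rule sum_mono) simp
  also have "\<dots> \<le> (\<Sum>x\<in>V. real (card {e \<in> M. x \<in> e}))" using V by (intro sum_mono2) auto
  also have "\<dots> = real r * real (card M)"
    using sum_degrees[OF V(1) M] by (metis of_nat_mult of_nat_sum)
  also have "\<dots> \<le> real r * (\<epsilon> * real n ^ r)" using Mn by (intro mult_left_mono) auto
  also have "real n ^ r = real n * real n ^ (r - 1)" using r by (metis Suc_diff_1 Suc_le_eq One_nat_def power_Suc)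
  finally have "(real (card ?B) * \<delta>) * real n ^ (r - 1) \<le> (real r * \<epsilon> * real n) * real n ^ (r - 1)"
    by (simp add: algebra_simps)
  then show ?thesis using V(3) by (simp only: mult_le_cancel_right_pos zero_less_power of_nat_0_less_iff)
qed

text \<open>A union bound over the vertices of \<open>B\<close>. Link sets that are not rainbow will
  be seen to meet the small set of bad vertices, so they are few.\<close>

lemma card_meeting_le:
  assumes V: "finite V" and B: "finite B" and r: "r \<ge> 2"
    and L: "L \<subseteq> nsets V (r - 1)" "\<And>I. I \<in> L \<Longrightarrow> B \<inter> I \<noteq> {}"
  shows "card L \<le> card B * card V ^ (r - 2)"
proof -
  let ?L = "\<lambda>b. {I \<in> nsets V (r - 1). b \<in> I}"
  have "card (?L b) \<le> card V ^ (r - 2)" for b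
  proof -
    have "card (?L b) \<le> card (nsets V (r - 2))"
    proof (rule card_inj_on_le[of "\<lambda>I. I - {b}"])
      show "inj_on (\<lambda>I. I - {b}) (?L b)" by (auto simp: inj_on_def)
      show "(\<lambda>I. I - {b}) ` ?L b \<subseteq> nsets V (r - 2)"
        using r by (auto simp: nsets_def)
      show "finite (nsets V (r - 2))" using V by (rule finite_imp_finite_nsets)
    qed
    also have "\<dots> \<le> card V ^ (r - 2)" using V by (rule card_nsets_le)
    finally show ?thesis .
  qed
  then have "(\<Sum>b\<in>B. card (?L b)) \<le> (\<Sum>b\<in>B. card V ^ (r - 2))" by (intro sum_mono)
  moreover have "card (\<Union>b\<in>B. ?L b) \<le> (\<Sum>b\<in>B. card (?L b))" using B by (rule card_UN_le)
  moreover have "card L \<le> card (\<Union>b\<in>B. ?L b)"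
  proof (rule card_mono)
    show "finite (\<Union>b\<in>B. ?L b)"
      by (intro finite_UN_I B finite_subset[OF Collect_restrict] finite_imp_finite_nsets V)
    show "L \<subseteq> (\<Union>b\<in>B. ?L b)"
    proof
      fix I assume I: "I \<in> L"
      then obtain b where "b \<in> B" "b \<in> I" using L(2) by blast
      then show "I \<in> (\<Union>b\<in>B. ?L b)" using I L(1) by blast
    qed
  qed
  ultimately show ?thesis by simp
qed

lemma card_by_type:
  fixes c :: "'b \<Rightarrow> nat"
  assumes V: "finite V" and c: "c \<in> V \<rightarrow> {1..t}" and L: "L \<subseteq> nsets V k"
  shows "card L = card {I \<in> L. \<not> inj_on c I} + (\<Sum>T\<in>nsets {1..t} k. card {I \<in> L. c ` I = T})"
proof -
  have finL: "finite L" using L V finite_imp_finite_nsets finite_subset by blast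
  have "card L = card {I \<in> L. \<not> inj_on c I} + card {I \<in> L. inj_on c I}"
    using finL by (subst card_Un_disjoint[symmetric]) (auto intro: arg_cong[of _ _ card])
  also have "card {I \<in> L. inj_on c I}
      = (\<Sum>T\<in>nsets {1..t} k. \<Sum>I\<in>{I \<in> {I \<in> L. inj_on c I}. c ` I = T}. 1)"
  proof (subst sum.group)
    show "finite (nsets {1..t} k)" by (rule finite_imp_finite_nsets) simp
    have "{I \<in> L. inj_on c I} \<subseteq> rainbow k V c" using L by (auto simp: rainbow_def)
    then show "(\<lambda>I. c ` I) ` {I \<in> L. inj_on c I} \<subseteq> nsets {1..t} k"
      using rainbow_image_colors[OF _ c] by blast
  qed (use finL in simp_all)
  also have "\<dots> = (\<Sum>T\<in>nsets {1..t} k. card {I \<in> L. c ` I = T})"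
  proof (rule sum.cong[OF refl])
    fix T assume T: "T \<in> nsets {1..t} k"
    have "inj_on c I" if "I \<in> L" "c ` I = T" for I
      using that T L by (intro eq_card_imp_inj_on) (auto simp: nsets_def)
    then have "{I \<in> {I \<in> L. inj_on c I}. c ` I = T} = {I \<in> L. c ` I = T}" by blast
    then show "(\<Sum>I\<in>{I \<in> {I \<in> L. inj_on c I}. c ` I = T}. 1) = card {I \<in> L. c ` I = T}" by simp
  qed
  finally show ?thesis .
qed

text \<open>In units of \<open>N\<close>, a color set contributes at most \<open>q + \<tau>\<close>
  to the link of \<open>x\<close> and an infrequent one less than \<open>\<tau>\<close>. The degree
  therefore forces \<open>C\<close> frequent color sets, namely those avoiding a color
  \<open>i\<close>. If \<open>x\<close> had color \<open>i\<close>, its link would nearly agree with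
  that of the blowup, and optimality of \<open>c\<close> makes the actual color of \<open>x\<close>
  at least as good.\<close>

lemma optimal_coloring_degree_le:
  fixes G :: "'b hgraph" and \<tau> q N :: real
  assumes r: "r \<ge> 2" "t \<ge> r" and G: "rgraph r G" and V: "V = verts G"
    and c: "c \<in> V \<rightarrow> {1..t}"
    and opt: "\<And>c'. c' \<in> V \<rightarrow> {1..t} \<Longrightarrow>
      card (sym_diff (edges G) (rainbow r V c)) \<le> card (sym_diff (edges G) (rainbow r V c'))"
    and x: "x \<in> V"
    and S: "S = {T \<in> nsets {1..t} (r - 1). real (card {I \<in> link r G x. c ` I = T}) \<ge> \<tau> * N}"
    and Si: "card S \<ge> (t - 1) choose (r - 1) \<Longrightarrow> \<exists>i\<in>{1..t}. S = nsets ({1..t} - {i}) (r - 1)"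
    and C: "C = real ((t - 1) choose (r - 1))" and D: "D = real (t choose (r - 1))"
    and deg: "real (card (link r G x)) \<ge> (C * q - \<tau>) * N"
    and tc: "\<And>T. T \<in> nsets {1..t} (r - 1) \<Longrightarrow>
      real (card {I \<in> rainbow (r - 1) V c. c ` I = T}) \<le> (q + \<tau>) * N"
    and nr: "real (card {I \<in> link r G x. \<not> inj_on c I}) \<le> \<tau> * N"
    and \<tau>: "(C + D + 1) * \<tau> < q" "\<tau> > 0" and N: "N > 0"
  shows "real (card {e \<in> sym_diff (edges G) (rainbow r V c). x \<in> e}) \<le> (C + 2 * D + 3) * \<tau> * N"
proof -
  have finV: "finite V" using G V by (auto simp: rgraph_def)
  let ?L = "link r G x"
  let ?T = "nsets {1..t} (r - 1)"
  let ?LT = "\<lambda>T. {I \<in> ?L. c ` I = T}"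
  have finT: "finite ?T" by (simp add: finite_imp_finite_nsets)
  have LV: "?L \<subseteq> nsets V (r - 1)"
  proof
    fix I assume I: "I \<in> ?L"
    then have "insert x I \<in> nsets V r" using G V unfolding link_def rgraph_def by blast
    then show "I \<in> nsets V (r - 1)" using I unfolding link_def nsets_def by simp
  qed
  have finL: "finite ?L" using LV finV finite_imp_finite_nsets finite_subset by blast
  have xL: "x \<notin> I" if "I \<in> ?L" for I using that link_rgraph[OF G r(1)] by blast
  have ST: "S \<subseteq> ?T" using S by blast
  have finS: "finite S" using ST finT finite_subset by blast
  have LT_le: "real (card (?LT T)) \<le> (q + \<tau>) * N" if T: "T \<in> ?T" for T
  proof -
    have "card (?LT T) \<le> card {I \<in> rainbow (r - 1) V c. c ` I = T}"
    proof (rule card_mono)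
      show "finite {I \<in> rainbow (r - 1) V c. c ` I = T}"
        by (rule finite_subset[OF Collect_restrict finite_rainbow[OF finV]])
      show "?LT T \<subseteq> {I \<in> rainbow (r - 1) V c. c ` I = T}"
      proof
        fix I assume I: "I \<in> ?LT T"
        then have "I \<in> nsets V (r - 1)" using LV by blast
        moreover from this have "inj_on c I" using I T by (intro eq_card_imp_inj_on) (auto simp: nsets_def)
        ultimately show "I \<in> {I \<in> rainbow (r - 1) V c. c ` I = T}" using I by (simp add: rainbow_def)
      qed
    qed
    then show ?thesis using tc[OF T] by linarith
  qed
  have small: "(\<Sum>T\<in>?T - S. real (card (?LT T))) \<le> D * (\<tau> * N)"
  proof -
    have "(\<Sum>T\<in>?T - S. real (card (?LT T))) \<le> (\<Sum>T\<in>?T - S. \<tau> * N)"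
      by (rule sum_mono) (use S in auto)
    also have "\<dots> = real (card (?T - S)) * (\<tau> * N)" by simp
    also have "\<dots> \<le> D * (\<tau> * N)"
    proof (rule mult_right_mono)
      have "card (?T - S) \<le> card ?T" using finT by (intro card_mono) auto
      then show "real (card (?T - S)) \<le> D" unfolding D by simp
      show "0 \<le> \<tau> * N" using \<tau> N by simp
    qed
    finally show ?thesis .
  qed
  have total: "real (card ?L) \<le> \<tau> * N + (\<Sum>T\<in>S. real (card (?LT T))) + D * (\<tau> * N)"
  proof -
    have "real (card ?L) = real (card {I \<in> ?L. \<not> inj_on c I}) + (\<Sum>T\<in>?T. real (card (?LT T)))"
      using card_by_type[OF finV c LV] by simp
    also have "(\<Sum>T\<in>?T. real (card (?LT T))) = (\<Sum>T\<in>?T - S. real (card (?LT T))) + (\<Sum>T\<in>S. real (card (?LT T)))"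
      using ST finT by (rule sum.subset_diff)
    finally show ?thesis using nr small by linarith
  qed
  \<comment> \<open>With at most \<open>C - 1\<close> frequent sets the link would be smaller than
    its lower bound by about \<open>q\<close>; the error terms add up to
    \<open>(C + D + 1) * \<tau>\<close>, which is less than \<open>q\<close>.\<close>
  have "card S \<ge> (t - 1) choose (r - 1)"
  proof (rule ccontr)
    assume "\<not> ?thesis"
    then have "real (card S) \<le> C - 1" unfolding C by linarith
    have "(\<Sum>T\<in>S. real (card (?LT T))) \<le> (\<Sum>T\<in>S. (q + \<tau>) * N)"
      using LT_le ST by (intro sum_mono) blast
    also have "\<dots> = real (card S) * ((q + \<tau>) * N)" by simp
    also have "\<dots> \<le> (C - 1) * ((q + \<tau>) * N)"
    proof (rule mult_right_mono[OF \<open>real (card S) \<le> C - 1\<close>])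
      have "0 \<le> (C + D + 1) * \<tau>" using \<tau> unfolding C D by simp
      then show "0 \<le> (q + \<tau>) * N" using \<tau> N by simp
    qed
    finally have "(C * q - \<tau>) * N \<le> \<tau> * N + (C - 1) * ((q + \<tau>) * N) + D * (\<tau> * N)"
      using total deg by linarith
    then have "q * N \<le> (C + D + 1) * \<tau> * N" by (simp add: algebra_simps)
    then have "q \<le> (C + D + 1) * \<tau>" using N by (simp only: mult_le_cancel_right_pos)
    then show False using \<tau> by simp
  qed
  then obtain i where i: "i \<in> {1..t}" and Seq: "S = nsets ({1..t} - {i}) (r - 1)" using Si by blast
  have cardS: "real (card S) = C" using i unfolding Seq C by simp
  define R where "R = {I \<in> nsets (V - {x}) (r - 1). inj_on c I \<and> c ` I \<in> S}"
  have finR: "finite R" unfolding R_def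
    by (intro finite_subset[OF Collect_restrict] finite_imp_finite_nsets finite_Diff finV)
  have R_le: "real (card R) \<le> C * ((q + \<tau>) * N)"
  proof -
    have "card R = card {I \<in> R. \<not> inj_on c I} + (\<Sum>T\<in>?T. card {I \<in> R. c ` I = T})"
      by (rule card_by_type[OF finV c]) (auto simp: R_def nsets_def)
    also have "{I \<in> R. \<not> inj_on c I} = {}" by (auto simp: R_def)
    also have "(\<Sum>T\<in>?T. card {I \<in> R. c ` I = T}) = (\<Sum>T\<in>S. card {I \<in> R. c ` I = T})"
    proof (rule sum.mono_neutral_right[OF finT ST], rule ballI)
      fix T assume "T \<in> ?T - S"
      then have "{I \<in> R. c ` I = T} = {}" by (auto simp: R_def)
      then show "card {I \<in> R. c ` I = T} = 0" by (simp only: card.empty)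
    qed
    finally have "real (card R) = (\<Sum>T\<in>S. real (card {I \<in> R. c ` I = T}))" by simp
    also have "\<dots> \<le> (\<Sum>T\<in>S. (q + \<tau>) * N)"
    proof (rule sum_mono)
      fix T assume "T \<in> S"
      have "card {I \<in> R. c ` I = T} \<le> card {I \<in> rainbow (r - 1) V c. c ` I = T}"
        by (intro card_mono finite_subset[OF Collect_restrict finite_rainbow[OF finV]])
          (auto simp: R_def rainbow_def nsets_def)
      then show "real (card {I \<in> R. c ` I = T}) \<le> (q + \<tau>) * N" using tc[of T] ST \<open>T \<in> S\<close> by force
    qed
    finally show ?thesis using cardS by simp
  qed
  have LR: "real (card (?L - R)) \<le> \<tau> * N + D * (\<tau> * N)"
  proof -
    have "?L - R \<subseteq> nsets V (r - 1)" using LV by blast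
    from card_by_type[OF finV c this]
    have "real (card (?L - R)) = real (card {I \<in> ?L - R. \<not> inj_on c I})
        + (\<Sum>T\<in>?T. real (card {I \<in> ?L - R. c ` I = T}))" by simp
    moreover have "card {I \<in> ?L - R. \<not> inj_on c I} \<le> card {I \<in> ?L. \<not> inj_on c I}"
      using finL by (intro card_mono) auto
    moreover have "(\<Sum>T\<in>?T. real (card {I \<in> ?L - R. c ` I = T})) = (\<Sum>T\<in>?T - S. real (card {I \<in> ?L - R. c ` I = T}))"
    proof (rule sum.mono_neutral_right[OF finT], blast, rule ballI)
      fix T assume "T \<in> ?T - (?T - S)"
      then have T: "T \<in> S" "T \<in> ?T" by blast+
      have "I \<in> R" if I: "I \<in> ?L" "c ` I = T" for I
      proof -
        have "I \<in> nsets V (r - 1)" using I LV by blast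
        moreover from this have "inj_on c I" using I T by (intro eq_card_imp_inj_on) (auto simp: nsets_def)
        ultimately show ?thesis using I T xL[OF I(1)] by (auto simp: R_def nsets_def)
      qed
      then have "{I \<in> ?L - R. c ` I = T} = {}" by blast
      then show "real (card {I \<in> ?L - R. c ` I = T}) = 0" by (simp only: card.empty of_nat_0)
    qed
    moreover have "(\<Sum>T\<in>?T - S. real (card {I \<in> ?L - R. c ` I = T})) \<le> (\<Sum>T\<in>?T - S. real (card (?LT T)))"
      using finL by (intro sum_mono of_nat_mono card_mono) auto
    ultimately show ?thesis using nr small by linarith
  qed
  \<comment> \<open>Only the excess of the link over \<open>R\<close> has been estimated directly.
    The other side follows from the sizes, as the symmetric difference is
    \<open>2 * card (?L - R) + card R - card ?L\<close>; the coefficients add up to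
    \<open>2 + 2 * D + C + 1\<close>.\<close>
  have "real (card (sym_diff ?L R)) \<le> (C + 2 * D + 3) * \<tau> * N"
  proof -
    have "card (sym_diff ?L R) \<le> card (?L - R) + card (R - ?L)" by (rule card_Un_le)
    moreover have "card (R - ?L) + card (?L \<inter> R) = card R"
      using card_Int_Diff[OF finR, of ?L] by (simp add: Int_commute)
    moreover have "card (?L - R) + card (?L \<inter> R) = card ?L"
      using card_Int_Diff[OF finL, of R] by simp
    ultimately have "real (card (sym_diff ?L R)) \<le> 2 * real (card (?L - R)) + real (card R) - real (card ?L)"
      by linarith
    also have "\<dots> \<le> 2 * (\<tau> * N + D * (\<tau> * N)) + C * ((q + \<tau>) * N) - (C * q - \<tau>) * N"
      by (intro diff_mono add_mono mult_left_mono LR R_le deg) simp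
    also have "\<dots> = (C + 2 * D + 3) * \<tau> * N" by (simp add: algebra_simps)
    finally show ?thesis .
  qed
  \<comment> \<open>\<open>R\<close> is the link of \<open>x\<close> in the complete multipartite graph obtained by recoloring \<open>x\<close> with \<open>i\<close>.\<close>
  moreover define c' where "c' = c(x := i)"
  have c': "c' \<in> V \<rightarrow> {1..t}" using Pi_mem[OF c] i by (simp add: c'_def)
  have "card {e \<in> sym_diff (edges G) (rainbow r V c'). x \<in> e} = card (sym_diff ?L R)"
  proof (rule card_containing)
    show "x \<notin> \<Union>(sym_diff ?L R)" using xL by (auto simp: R_def nsets_def)
    fix e assume xe: "x \<in> e"
    have ie: "insert x (e - {x}) = e" using xe by blast
    have "e \<in> edges G \<longleftrightarrow> e - {x} \<in> ?L"
      unfolding link_rgraph[OF G r(1)] ie by simp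
    moreover have "e \<in> rainbow r V c' \<longleftrightarrow> e - {x} \<in> R"
    proof -
      have "inj_on c' e \<longleftrightarrow> inj_on c' (e - {x}) \<and> c' x \<notin> c' ` (e - {x})"
        by (metis inj_on_insert Diff_idemp ie)
      also have "inj_on c' (e - {x}) \<longleftrightarrow> inj_on c (e - {x})" by (rule inj_on_cong) (simp add: c'_def)
      also have "c' ` (e - {x}) = c ` (e - {x})" by (rule image_cong) (auto simp: c'_def)
      also have "c' x = i" by (simp add: c'_def)
      finally have 1: "inj_on c' e \<longleftrightarrow> inj_on c (e - {x}) \<and> i \<notin> c ` (e - {x})" .
      have 2: "e \<in> nsets V r \<longleftrightarrow> e - {x} \<in> nsets (V - {x}) (r - 1)"
      proof
        assume "e \<in> nsets V r"
        then show "e - {x} \<in> nsets (V - {x}) (r - 1)" using xe by (auto simp: nsets_def)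
      next
        assume a: "e - {x} \<in> nsets (V - {x}) (r - 1)"
        then have "finite e" "e \<subseteq> V" using x by (auto simp: nsets_def)
        moreover have "card e = Suc (card (e - {x}))" using card_Suc_Diff1[OF \<open>finite e\<close> xe] by (rule sym)
        ultimately show "e \<in> nsets V r" using a r by (simp add: nsets_def)
      qed
      have 3: "c ` (e - {x}) \<in> S \<longleftrightarrow> i \<notin> c ` (e - {x})"
        if "e - {x} \<in> nsets (V - {x}) (r - 1)" "inj_on c (e - {x})"
      proof -
        have "e - {x} \<in> rainbow (r - 1) V c" using that by (auto simp: rainbow_def nsets_def)
        then have "c ` (e - {x}) \<in> ?T" using rainbow_image_colors[OF _ c] by blast
        then show ?thesis unfolding Seq nsets_def by blast
      qed
      show ?thesis unfolding rainbow_def R_def using 1 2 3 by blast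
    qed
    ultimately show "e \<in> sym_diff (edges G) (rainbow r V c') \<longleftrightarrow> e - {x} \<in> sym_diff ?L R" by blast
  qed
  \<comment> \<open>Recoloring \<open>x\<close> affects only sets through \<open>x\<close>, so
    global minimality of the distance is minimality of the contribution of \<open>x\<close>.\<close>
  moreover have "card {e \<in> sym_diff (edges G) (rainbow r V c). x \<in> e}
      \<le> card {e \<in> sym_diff (edges G) (rainbow r V c'). x \<in> e}"
  proof -
    have fin: "finite (sym_diff (edges G) (rainbow r V d))" for d :: "'b \<Rightarrow> nat"
    proof -
      have "finite (edges G)" using G finite_imp_finite_nsets finite_subset by (auto simp: rgraph_def)
      then show ?thesis using finite_rainbow[OF finV] by simp
    qed
    have split: "card X = card {e \<in> X. x \<in> e} + card {e \<in> X. x \<notin> e}" if "finite X" for X :: "'b set set"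
      using that by (subst card_Un_disjoint[symmetric]) (auto intro: arg_cong[of _ _ card])
    have "e \<in> rainbow r V c \<longleftrightarrow> e \<in> rainbow r V c'" if "x \<notin> e" for e
    proof -
      have "inj_on c e \<longleftrightarrow> inj_on c' e" by (rule inj_on_cong) (use that in \<open>auto simp: c'_def\<close>)
      then show ?thesis by (simp add: rainbow_def)
    qed
    then have "{e \<in> sym_diff (edges G) (rainbow r V c). x \<notin> e}
        = {e \<in> sym_diff (edges G) (rainbow r V c'). x \<notin> e}" by blast
    then have "card {e \<in> sym_diff (edges G) (rainbow r V c). x \<notin> e}
        = card {e \<in> sym_diff (edges G) (rainbow r V c'). x \<notin> e}" by (simp only:)
    then show ?thesis using opt[OF c'] split[OF fin[of c]] split[OF fin[of c']] by linarith
  qed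
  ultimately show ?thesis by linarith
qed

text \<open>A bootstrap on the bad set \<open>B\<close>. The condition on
  \<open>real r * \<epsilon>\<close> gives \<open>B\<close> at most \<open>\<tau> * n\<close>
  vertices, so that links are nearly rainbow; the degree estimate then bounds the defect of every
  vertex by \<open>(C + 2 * D + 3) * \<tau>\<close>, which is at most the bound
  \<open>\<delta>\<^sub>1\<close> defining goodness, so \<open>B\<close> is empty.
  \<open>\<delta>\<^sub>1\<close> serves the embedding around a critical edge with choices of
  density \<open>g\<close>, and \<open>\<delta>\<^sub>2\<close> the spike embedding with density
  \<open>\<tau>\<close>.\<close>

lemma edges_subset_rainbow:
  fixes H :: "'a hgraph" and G :: "'b hgraph" and \<epsilon> \<delta>\<^sub>1 \<delta>\<^sub>2 g \<tau> q C D :: real and n :: nat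
  assumes r: "r \<ge> 2" "t \<ge> r" and H: "rgraph r H" and spike: "spike r t H F v"
    and G: "rgraph r G" "\<not> contains_copy G H" and V: "V = verts G" "card V = n" "n > 0"
    and c: "c \<in> V \<rightarrow> {1..t}"
    and opt: "\<And>c'. c' \<in> V \<rightarrow> {1..t} \<Longrightarrow>
      card (sym_diff (edges G) (rainbow r V c)) \<le> card (sym_diff (edges G) (rainbow r V c'))"
    and d: "real (card (sym_diff (edges G) (rainbow r V c))) \<le> \<epsilon> * real n ^ r"
    and s: "s = real (card (edges H) + card (verts H) ^ 2 + card (verts H))"
    and g: "0 < g" "g \<le> 1" and \<tau>: "0 < \<tau>" "\<tau> \<le> g"
    and parts: "\<And>i. i \<in> {1..t} \<Longrightarrow> real (card {x \<in> V. c x = i}) \<ge> g * real n"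
    and small: "s * \<delta>\<^sub>1 < g ^ card (verts H)" "s * \<delta>\<^sub>2 < \<tau> ^ card (verts H)"
    and large: "real r \<le> \<delta>\<^sub>1 * real n" "1 \<le> \<delta>\<^sub>2 * real n"
    and \<epsilon>: "\<epsilon> \<le> \<delta>\<^sub>1" "\<epsilon> \<le> \<delta>\<^sub>2" "real r * \<epsilon> \<le> \<tau> * \<delta>\<^sub>1"
    and C: "C = real ((t - 1) choose (r - 1))" and D: "D = real (t choose (r - 1))"
    and deg: "\<And>x. x \<in> V \<Longrightarrow> real (card (link r G x)) \<ge> (C * q - \<tau>) * real n ^ (r - 1)"
    and tc: "\<And>T. T \<in> nsets {1..t} (r - 1) \<Longrightarrow>
      real (card {I \<in> rainbow (r - 1) V c. c ` I = T}) \<le> (q + \<tau>) * real n ^ (r - 1)"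
    and \<tau>q: "(C + D + 1) * \<tau> < q" and \<tau>\<delta>: "(C + 2 * D + 3) * \<tau> \<le> \<delta>\<^sub>1"
  shows "edges G \<subseteq> rainbow r V c"
proof -
  have finV: "finite V" using G V by (auto simp: rgraph_def)
  have EV: "edges G \<subseteq> nsets V r" using G V by (simp add: rgraph_def)
  have finE: "finite (edges G)" using EV finV finite_imp_finite_nsets finite_subset by blast
  have F: "freely_critical r t H F" using spike by (simp add: spike_def)
  let ?N = "real n ^ (r - 1)"
  have N: "?N > 0" using V by simp
  define M where "M = rainbow r V c - edges G"
  have finSD: "finite (sym_diff (edges G) (rainbow r V c))" using finE finite_rainbow[OF finV] by simp
  have "card M \<le> card (sym_diff (edges G) (rainbow r V c))"
    unfolding M_def using finSD by (intro card_mono) auto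
  then have Mn: "real (card M) \<le> \<epsilon> * real n ^ r" using d by linarith
  have le: "\<epsilon> * real n ^ r \<le> \<delta>\<^sub>1 * real n ^ r" "\<epsilon> * real n ^ r \<le> \<delta>\<^sub>2 * real n ^ r"
    using \<epsilon> by (auto intro: mult_right_mono)
  have M1: "real (card M) \<le> \<delta>\<^sub>1 * real n ^ r" and M2: "real (card M) \<le> \<delta>\<^sub>2 * real n ^ r"
    using Mn le by linarith+
  have "\<delta>\<^sub>1 * real n > 0" using large r by linarith
  then have \<delta>1: "\<delta>\<^sub>1 > 0" using V(3) by (simp add: zero_less_mult_iff)
  define B where "B = {x \<in> V. real (card {e \<in> M. x \<in> e}) > \<delta>\<^sub>1 * ?N}"
  have good: "\<not> {x, y} \<subseteq> e"
    if "x \<in> V - B" "y \<in> V - B" "x \<noteq> y" "c x = c y" "e \<in> edges G" for x y e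
  proof (rule edge_not_monochromatic_pair[OF r H F G V c M_def g parts _ large(1) M1])
    show "real (card (edges H) + card (verts H) ^ 2 + card (verts H)) * \<delta>\<^sub>1 < g ^ card (verts H)"
      using small(1) s by simp
    show "real (card {e \<in> M. x \<in> e}) \<le> \<delta>\<^sub>1 * ?N" "real (card {e \<in> M. y \<in> e}) \<le> \<delta>\<^sub>1 * ?N"
      using that by (auto simp: B_def)
  qed (use that in auto)
  \<comment> \<open>Stated for subsets of edges, as it is used twice: for link sets while
    \<open>B\<close> is only known to be small, and for whole edges once \<open>B\<close> is
    empty.\<close>
  have nonrainbow: "B \<inter> I \<noteq> {}" if I: "I \<subseteq> e" "e \<in> edges G" "\<not> inj_on c I" for I e
  proof -
    obtain y z where yz: "y \<in> I" "z \<in> I" "y \<noteq> z" "c y = c z" using I(3) by (auto simp: inj_on_def)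
    have "e \<subseteq> V" using I EV by (auto simp: nsets_def)
    then have "y \<in> V" "z \<in> V" using yz I by blast+
    then have "y \<in> B \<or> z \<in> B" using good[of y z e] yz I by blast
    then show ?thesis using yz by blast
  qed
  have cB: "real (card B) \<le> \<tau> * real n"
  proof -
    have "M \<subseteq> nsets V r" by (auto simp: M_def rainbow_def)
    then have "real (card B) * \<delta>\<^sub>1 \<le> real r * \<epsilon> * real n"
      unfolding B_def using card_large_degree_le[OF finV V(2,3) _ _ Mn] r by simp
    also have "\<dots> \<le> \<tau> * \<delta>\<^sub>1 * real n" using \<epsilon>(3) by (intro mult_right_mono) auto
    finally have "real (card B) * \<delta>\<^sub>1 \<le> (\<tau> * real n) * \<delta>\<^sub>1" by (simp add: algebra_simps)
    then show ?thesis using \<delta>1 by (simp only: mult_le_cancel_right_pos)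
  qed
  have "x \<notin> B" if x: "x \<in> V" for x
  proof -
    have LV: "link r G x \<subseteq> nsets V (r - 1)"
    proof
      fix I assume I: "I \<in> link r G x"
      then have "insert x I \<in> nsets V r" using EV unfolding link_def by blast
      then show "I \<in> nsets V (r - 1)" using I unfolding link_def nsets_def by simp
    qed
    have nr: "real (card {I \<in> link r G x. \<not> inj_on c I}) \<le> \<tau> * ?N"
    proof -
      have "card {I \<in> link r G x. \<not> inj_on c I} \<le> card B * card V ^ (r - 2)"
      proof (rule card_meeting_le[OF finV _ r(1)])
        show "finite B" unfolding B_def using finV by simp
        show "{I \<in> link r G x. \<not> inj_on c I} \<subseteq> nsets V (r - 1)" using LV by blast
        show "B \<inter> I \<noteq> {}" if I: "I \<in> {I \<in> link r G x. \<not> inj_on c I}" for I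
          using nonrainbow[of I "insert x I"] I by (auto simp: link_def)
      qed
      then have "real (card {I \<in> link r G x. \<not> inj_on c I}) \<le> real (card B) * real n ^ (r - 2)"
        using V(2) of_nat_mono[where ?'a = real] by fastforce
      also have "\<dots> \<le> \<tau> * real n * real n ^ (r - 2)" using cB by (intro mult_right_mono) auto
      also have "\<dots> = \<tau> * ?N"
      proof -
        have "r - 1 = Suc (r - 2)" using r by simp
        then show ?thesis by simp
      qed
      finally show ?thesis .
    qed
    define S where "S = {T \<in> nsets {1..t} (r - 1). real (card {I \<in> link r G x. c ` I = T}) \<ge> \<tau> * ?N}"
    have "\<exists>i\<in>{1..t}. S = nsets ({1..t} - {i}) (r - 1)" if "card S \<ge> (t - 1) choose (r - 1)"
    proof (rule link_types[OF r H spike G V M_def \<tau>(1) _ _ _ large(2) M2 x S_def that])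
      show "\<tau> \<le> 1" using \<tau> g by simp
      show "\<tau> * real n \<le> real (card {x \<in> V. c x = i})" if "i \<in> {1..t}" for i
        using parts[OF that] mult_right_mono[OF \<tau>(2), of "real n"] by simp
      show "real (card (edges H) + card (verts H) ^ 2 + card (verts H)) * \<delta>\<^sub>2 < \<tau> ^ card (verts H)"
        using small(2) s by simp
    qed
    then have "real (card {e \<in> sym_diff (edges G) (rainbow r V c). x \<in> e}) \<le> (C + 2 * D + 3) * \<tau> * ?N"
      by (intro optimal_coloring_degree_le[OF r G(1) V(1) c opt x S_def _ C D deg[OF x] tc nr \<tau>q \<tau>(1) N])
    also have "\<dots> \<le> \<delta>\<^sub>1 * ?N" using \<tau>\<delta> N by (intro mult_right_mono) auto
    finally have "real (card {e \<in> sym_diff (edges G) (rainbow r V c). x \<in> e}) \<le> \<delta>\<^sub>1 * ?N" .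
    moreover have "card {e \<in> M. x \<in> e} \<le> card {e \<in> sym_diff (edges G) (rainbow r V c). x \<in> e}"
      by (intro card_mono finite_subset[OF Collect_restrict finSD]) (auto simp: M_def)
    ultimately show ?thesis unfolding B_def by simp
  qed
  then have B: "B = {}" unfolding B_def by blast
  show ?thesis
  proof
    fix e assume e: "e \<in> edges G"
    then have "inj_on c e" using nonrainbow[of e e] B by blast
    then show "e \<in> rainbow r V c" using e EV by (auto simp: rainbow_def)
  qed
qed

section \<open>Asymptotic estimates and the choice of constants\<close>

lemma card_rainbow_type_le:
  fixes b b' :: real
  assumes V: "finite V" "card V = n" and T: "T \<in> nsets {1..t} k"
    and a: "\<And>i. i \<in> {1..t} \<Longrightarrow> real (card {x \<in> V. c x = i}) \<le> b * real n"
    and b: "b ^ k \<le> b'"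
  shows "real (card {I \<in> rainbow k V c. c ` I = T}) \<le> b' * real n ^ k"
proof -
  have T': "finite T" "card T = k" "T \<subseteq> {1..t}" using T by (auto simp: nsets_def)
  have "real (card {I \<in> rainbow k V c. c ` I = T}) = (\<Prod>i\<in>T. real (card {x \<in> V. c x = i}))"
    using card_rainbow_type[OF V(1) T'(1,2), of c] by simp
  also have "\<dots> \<le> (\<Prod>i\<in>T. b * real n)" using a T' by (intro prod_mono) auto
  also have "\<dots> = b ^ k * real n ^ k" using T' by (simp add: power_mult_distrib)
  also have "\<dots> \<le> b' * real n ^ k" using b by (intro mult_right_mono) auto
  finally show ?thesis .
qed

text \<open>Continuity at 0. The factor 3 matches the balance of the parts: the error
  \<open>2 * \<beta> * n + 1\<close> is at most \<open>3 * \<beta> * n\<close> for large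
  \<open>n\<close>.\<close>

lemma exists_perturbation_power_le:
  fixes x y z :: real
  assumes "x ^ k < y" "z > 0"
  obtains \<beta> where "\<beta> > 0" "\<beta> \<le> z" "(x + 3 * \<beta>) ^ k \<le> y"
proof -
  have "((\<lambda>b. (x + 3 * b) ^ k) \<longlongrightarrow> (x + 3 * 0) ^ k) (at_right 0)"
    by (intro tendsto_intros)
  then have "eventually (\<lambda>b. (x + 3 * b) ^ k < y) (at_right 0)"
    by (rule order_tendstoD) (use assms in simp)
  then obtain b where b: "b > 0" "\<And>y'. y' > 0 \<Longrightarrow> y' < b \<Longrightarrow> (x + 3 * y') ^ k < y"
    unfolding eventually_at_right_field by auto
  have "min (b / 2) z > 0" "min (b / 2) z < b" using b assms by (simp_all add: min_less_iff_disj)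
  then show ?thesis using that[of "min (b / 2) z"] b(2) by (simp add: less_imp_le)
qed

text \<open>Translates the minimum degree hypothesis, stated through the extremal number, into the
  units \<open>n ^ (r - 1)\<close> used for links.\<close>

lemma asymptotic_average_degree_ge:
  fixes \<epsilon> \<tau> :: real
  assumes r: "r \<ge> 2" "t \<ge> r" and \<tau>: "\<tau> > 0"
    and C: "C = real ((t - 1) choose (r - 1))" and \<epsilon>: "\<epsilon> \<le> \<tau> / (2 * C)" "0 \<le> \<epsilon>" "\<epsilon> \<le> 1"
  shows "eventually (\<lambda>n. real r * (1 - \<epsilon>) * real (max_edges (blowups r (complete_hgraph r t)) n) / real n
    \<ge> (C * (1 / real t) ^ (r - 1) - \<tau>) * real n ^ (r - 1)) sequentially"
proof -
  \<comment> \<open>\<open>X n * n ^ (r - 1)\<close> is the average degree that belongs to the lower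
    bound from the equitable coloring, rewritten with
    \<open>r * (t choose r) = t * C\<close>.\<close>
  define X where "X n = real t * C * (1 / real t - 1 / real n) ^ r" for n
  have t0: "real t > 0" using r by simp
  have C0: "C > 0" unfolding C using r by simp
  have rr: "r = Suc (r - 1)" using r by simp
  have lim: "real t * C * (1 / real t) ^ r = C * (1 / real t) ^ (r - 1)"
    using t0 by (subst rr) simp
  have "X \<longlonglongrightarrow> real t * C * (1 / real t - 0) ^ r"
    unfolding X_def by (intro tendsto_intros lim_1_over_n)
  then have "X \<longlonglongrightarrow> C * (1 / real t) ^ (r - 1)" using lim by simp
  then have "eventually (\<lambda>n. X n > C * (1 / real t) ^ (r - 1) - \<tau> / 2) sequentially"
    by (rule order_tendstoD) (use \<tau> in simp)
  then show ?thesis using eventually_ge_at_top[of t]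
  proof eventually_elim
    case (elim n)
    define m where "m = real (max_edges (blowups r (complete_hgraph r t)) n)"
    have n0: "real n > 0" using elim r by simp
    have ge: "real (t choose r) * (real n / real t - 1) ^ r \<le> m"
      unfolding m_def using r elim by (intro max_edges_ge) auto
    have rt: "real r * real (t choose r) = real t * C"
    proof -
      have "r * (t choose r) = t * ((t - 1) choose (r - 1))"
        using times_binomial_minus1_eq[of r t] r by simp
      then show ?thesis unfolding C by (metis of_nat_mult)
    qed
    have tn: "0 \<le> 1 / real t - 1 / real n" "1 / real t - 1 / real n \<le> 1 / real t"
      using elim(2) t0 n0 by (simp_all add: frac_le)
    have Xle: "X n \<le> C"
    proof -
      have "X n \<le> real t * C * (1 / real t) ^ r"
        unfolding X_def using tn C0 t0 by (intro mult_left_mono power_mono) auto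
      also have "\<dots> \<le> C * 1"
        unfolding lim using C0 t0 r by (intro mult_left_mono power_le_one) auto
      finally show ?thesis by simp
    qed
    have X0: "X n \<ge> 0" unfolding X_def using tn C0 by simp
    have "real r * real (t choose r) * (real n / real t - 1) ^ r / real n = X n * real n ^ (r - 1)"
    proof -
      have "real n / real t - 1 = (1 / real t - 1 / real n) * real n" using n0 by (simp add: algebra_simps)
      then have "(real n / real t - 1) ^ r = (1 / real t - 1 / real n) ^ r * real n ^ r"
        by (simp add: power_mult_distrib)
      also have "real n ^ r = real n ^ (r - 1) * real n" by (subst rr) simp
      finally show ?thesis unfolding X_def rt using n0 by simp
    qed
    moreover have "real r * (real (t choose r) * (real n / real t - 1) ^ r) / real n \<le> real r * m / real n"
      using ge by (intro divide_right_mono mult_left_mono) auto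
    ultimately have "X n * real n ^ (r - 1) \<le> real r * m / real n" by (simp add: mult.assoc)
    then have "(1 - \<epsilon>) * (X n * real n ^ (r - 1)) \<le> (1 - \<epsilon>) * (real r * m / real n)"
      using \<epsilon> by (intro mult_left_mono) auto
    moreover have "(C * (1 / real t) ^ (r - 1) - \<tau>) * real n ^ (r - 1) \<le> ((1 - \<epsilon>) * X n) * real n ^ (r - 1)"
    proof (rule mult_right_mono)
      \<comment> \<open>One half of \<open>\<tau>\<close> pays for the factor
        \<open>1 - \<epsilon>\<close>, using \<open>X n \<le> C\<close>; the other half was spent on
        convergence.\<close>
      have "\<epsilon> * X n \<le> \<tau> / (2 * C) * C" using \<epsilon> Xle X0 C0 \<tau> by (intro mult_mono) auto
      then have "\<epsilon> * X n \<le> \<tau> / 2" using C0 by simp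
      then show "C * (1 / real t) ^ (r - 1) - \<tau> \<le> (1 - \<epsilon>) * X n"
        using elim(1) by (simp add: algebra_simps)
    qed simp
    ultimately show ?case unfolding m_def by (simp add: algebra_simps)
  qed
qed

theorem theorem3p1:
  fixes r t :: nat and H :: "'a hgraph"
  assumes "r \<ge> 2" and "t \<ge> r"
    and "rgraph r H"
    and "sharply_critical r t H"
  shows "vertex_locally_stable r (Forb r H) (blowups r (complete_hgraph r t))"
proof -
  note r = assms(1,2) and H = assms(3)
  let ?\<BB> = "blowups r (complete_hgraph r t)"
  obtain F v where spike: "spike r t H F v" using assms(4) by (auto simp: sharply_critical_def)
  have t0: "real t > 0" using r by simp
  \<comment> \<open>\<open>s\<close> bounds the number of rare events in both embeddings, and
    \<open>h\<close> the number of blocks. For choices of density \<open>x\<close>, the tolerance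
    \<open>x ^ h / (s + 1)\<close> satisfies the smallness condition; it is used with
    \<open>x = g\<close> and with \<open>x = \<tau>\<close>.\<close>
  define s where "s = real (card (edges H) + card (verts H) ^ 2 + card (verts H))"
  define h where "h = card (verts H)"
  \<comment> \<open>Half of the average density of a part.\<close>
  define g where "g = 1 / (2 * real t)"
  define \<delta>\<^sub>1 where "\<delta>\<^sub>1 = g ^ h / (s + 1)"
  define q where "q = (1 / real t) ^ (r - 1)"
  define C where "C = real ((t - 1) choose (r - 1))"
  define D where "D = real (t choose (r - 1))"
  \<comment> \<open>The denominator \<open>C + 2 * D + 4\<close> exceeds both
    \<open>C + D + 1\<close>, giving the strict comparison with \<open>q\<close>, and
    \<open>C + 2 * D + 3\<close>, giving the comparison with
    \<open>\<delta>\<^sub>1\<close>.\<close>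
  define \<tau> where "\<tau> = min (min \<delta>\<^sub>1 q / (C + 2 * D + 4)) g"
  define \<delta>\<^sub>2 where "\<delta>\<^sub>2 = \<tau> ^ h / (s + 1)"
  have s0: "s \<ge> 0" by (simp add: s_def)
  have g0: "0 < g" "g \<le> 1" using t0 r by (simp_all add: g_def field_simps)
  have small: "s * (x ^ h / (s + 1)) < x ^ h" "x ^ h / (s + 1) > 0" if "x > 0" for x
    using that s0 by (simp_all add: field_simps)
  have \<delta>1: "\<delta>\<^sub>1 > 0" "s * \<delta>\<^sub>1 < g ^ h" unfolding \<delta>\<^sub>1_def using small[OF g0(1)] by simp_all
  have q0: "q > 0" using t0 by (simp add: q_def)
  have C0: "C > 0" unfolding C_def using r by simp
  have D0: "D \<ge> 0" by (simp add: D_def)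
  have CD: "C + 2 * D + 4 > 0" using C0 D0 by simp
  have \<tau>0: "\<tau> > 0" unfolding \<tau>_def using \<delta>1 q0 CD g0 by simp
  have \<tau>g: "\<tau> \<le> g" by (simp add: \<tau>_def)
  have "\<tau> \<le> min \<delta>\<^sub>1 q / (C + 2 * D + 4)" by (simp add: \<tau>_def)
  then have \<tau>CD: "(C + 2 * D + 4) * \<tau> \<le> min \<delta>\<^sub>1 q" using CD by (simp add: field_simps)
  have \<tau>q: "(C + D + 1) * \<tau> < q"
  proof -
    have "(C + D + 1) * \<tau> < (C + 2 * D + 4) * \<tau>" using D0 \<tau>0 by (intro mult_strict_right_mono) auto
    then show ?thesis using \<tau>CD by linarith
  qed
  have \<tau>\<delta>: "(C + 2 * D + 3) * \<tau> \<le> \<delta>\<^sub>1"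
  proof -
    have "(C + 2 * D + 3) * \<tau> \<le> (C + 2 * D + 4) * \<tau>" using \<tau>0 by (intro mult_right_mono) auto
    then show ?thesis using \<tau>CD by linarith
  qed
  have \<delta>2: "\<delta>\<^sub>2 > 0" "s * \<delta>\<^sub>2 < \<tau> ^ h" unfolding \<delta>\<^sub>2_def using small[OF \<tau>0] by simp_all
  \<comment> \<open>The bound \<open>1 / (6 * real t)\<close> means
    \<open>3 * \<beta> \<le> g\<close>, so balanced parts keep at least \<open>g * n\<close>
    vertices; the power bound limits each color set to \<open>q + \<tau>\<close> units.\<close>
  obtain \<beta> where \<beta>: "\<beta> > 0" "\<beta> \<le> 1 / (6 * real t)" "(1 / real t + 3 * \<beta>) ^ (r - 1) \<le> q + \<tau>"
    using exists_perturbation_power_le[of "1 / real t" "r - 1" "q + \<tau>" "1 / (6 * real t)"] \<tau>0 t0 by (auto simp: q_def)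
  \<comment> \<open>For \<open>n \<ge> 2 * t\<close> one has \<open>n / t - 1 \<ge> g * n\<close>,
    so the extremal number is at least \<open>\<gamma> * n ^ r\<close>.\<close>
  define \<gamma> where "\<gamma> = real (t choose r) * g ^ r"
  have \<gamma>0: "\<gamma> > 0" unfolding \<gamma>_def using r g0 by simp
  \<comment> \<open>The first two entries are the balancing conditions for
    \<open>\<eta> = 2 * \<epsilon>\<close>: the coloring loses \<open>\<epsilon> * n ^ r\<close>
    through the degree hypothesis and as much again through the distance.\<close>
  define \<epsilon> where "\<epsilon> = Min {\<gamma> / 4, \<gamma> * \<beta>\<^sup>2 / 12, \<tau> / (2 * C), \<tau> * \<delta>\<^sub>1 / real r, \<delta>\<^sub>1, \<delta>\<^sub>2, 1}"
  have \<epsilon>: "\<epsilon> \<le> \<gamma> / 4" "\<epsilon> \<le> \<gamma> * \<beta>\<^sup>2 / 12" "\<epsilon> \<le> \<tau> / (2 * C)" "\<epsilon> \<le> \<tau> * \<delta>\<^sub>1 / real r" "\<epsilon> \<le> \<delta>\<^sub>1" "\<epsilon> \<le> \<delta>\<^sub>2" "\<epsilon> \<le> 1"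
    unfolding \<epsilon>_def by (rule Min_le; simp)+
  have \<epsilon>0: "\<epsilon> > 0"
    unfolding \<epsilon>_def using \<gamma>0 \<beta> \<tau>0 C0 \<delta>1 \<delta>2 r by (subst Min_gr_iff) auto
  have r\<epsilon>: "real r * \<epsilon> \<le> \<tau> * \<delta>\<^sub>1" using \<epsilon>(4) r by (simp add: field_simps)
  have "eventually (\<lambda>n. real r * (1 - \<epsilon>) * real (max_edges ?\<BB> n) / real n
    \<ge> (C * q - \<tau>) * real n ^ (r - 1)) sequentially"
    unfolding q_def using asymptotic_average_degree_ge[OF r \<tau>0 C_def \<epsilon>(3) _ \<epsilon>(7)] \<epsilon>0 by simp
  then obtain n1 where n1: "\<And>n. n \<ge> n1 \<Longrightarrow>
      (C * q - \<tau>) * real n ^ (r - 1) \<le> real r * (1 - \<epsilon>) * real (max_edges ?\<BB> n) / real n"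
    unfolding eventually_sequentially by blast
  \<comment> \<open>In order: the degree asymptotics apply, \<open>n / t - 1\<close> is at least
    \<open>n / (2 * t)\<close>, \<open>1 \<le> \<beta> * n\<close> absorbs the rounding in the part
    sizes, and the last two entries give the size conditions of the embeddings.\<close>
  define n0 where "n0 = Max {n1, 2 * t, nat \<lceil>1 / \<beta>\<rceil>, nat \<lceil>real r / \<delta>\<^sub>1\<rceil>, nat \<lceil>1 / \<delta>\<^sub>2\<rceil>}"
  have n0: "n1 \<le> n0" "2 * t \<le> n0" "nat \<lceil>1 / \<beta>\<rceil> \<le> n0" "nat \<lceil>real r / \<delta>\<^sub>1\<rceil> \<le> n0" "nat \<lceil>1 / \<delta>\<^sub>2\<rceil> \<le> n0"
    unfolding n0_def by (rule Max_ge; simp)+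
  have "real (card (edges G)) \<le> real (max_edges ?\<BB> n) - 1 * real (edit_distance ?\<BB> G)"
    if GF: "G \<in> Forb r H" and Gn: "card (verts G) = n" and n: "n \<ge> n0"
      and dist: "real (edit_distance ?\<BB> G) \<le> \<epsilon> * real n ^ r"
      and mindeg: "\<forall>v\<in>verts G. real (card (link r G v)) \<ge> real r * (1 - \<epsilon>) * real (max_edges ?\<BB> n) / real n"
    for G n
  proof -
    define V where "V = verts G"
    have G: "rgraph r G" "\<not> contains_copy G H" using GF by (auto simp: Forb_def)
    have V: "finite V" "card V = n" using G Gn by (auto simp: V_def rgraph_def)
    have EV: "edges G \<subseteq> nsets V r" using G by (simp add: V_def rgraph_def)
    have finE: "finite (edges G)" using EV V(1) finite_imp_finite_nsets finite_subset by blast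
    have t1: "t \<ge> 1" using r by simp
    have nt: "n \<ge> 2 * t" using n n0 by linarith
    then have npos: "n > 0" using r by linarith
    have large_n: "x \<le> y * real n" if "y > 0" "nat \<lceil>x / y\<rceil> \<le> n0" for x y :: real
    proof -
      have "x / y \<le> real n" using that(2) n by linarith
      then show ?thesis using that(1) by (simp add: field_simps)
    qed
    obtain c where c: "c \<in> V \<rightarrow> {1..t}"
      and ed: "edit_distance ?\<BB> G = card (sym_diff (edges G) (rainbow r V c))"
      and opt: "\<And>c'. c' \<in> V \<rightarrow> {1..t} \<Longrightarrow>
        card (sym_diff (edges G) (rainbow r V c)) \<le> card (sym_diff (edges G) (rainbow r V c'))"
      using edit_distance_blowups[OF r(1) t1, of G] V(1) EV unfolding V_def by blast
    define m where "m = real (max_edges ?\<BB> n)"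
    have mle: "m \<le> real n ^ r"
      unfolding m_def using max_edges_le[OF r(1) t1, of n] by (metis of_nat_le_iff of_nat_power)
    have mge: "m \<ge> \<gamma> * real n ^ r"
    proof -
      have "g * real n \<le> real n / real t - 1" using nt t0 by (simp add: g_def field_simps)
      then have "(g * real n) ^ r \<le> (real n / real t - 1) ^ r" using g0 by (intro power_mono) auto
      then have "real (t choose r) * (g * real n) ^ r \<le> real (t choose r) * (real n / real t - 1) ^ r"
        by (intro mult_left_mono) auto
      also have "\<dots> \<le> m" unfolding m_def by (rule max_edges_ge[OF r(1) t1]) (use nt in simp)
      finally show ?thesis by (simp add: \<gamma>_def power_mult_distrib mult.assoc)
    qed
    \<comment> \<open>Summing the minimum degree condition over all vertices: \<open>G\<close>
      itself is nearly extremal, hence so is its nearest blowup.\<close>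
    have cG: "real (card (edges G)) \<ge> (1 - \<epsilon>) * m"
    proof -
      have "real n * (real r * (1 - \<epsilon>) * m / real n) = (\<Sum>x\<in>V. real r * (1 - \<epsilon>) * m / real n)"
        using V by simp
      also have "\<dots> \<le> (\<Sum>x\<in>V. real (card (link r G x)))"
        unfolding m_def using mindeg V_def by (intro sum_mono) blast
      also have "\<dots> = real (\<Sum>x\<in>V. card {e \<in> edges G. x \<in> e})"
        using card_link[OF G(1) r(1)] by simp
      also have "\<dots> = real r * real (card (edges G))" unfolding sum_degrees[OF V(1) EV] by simp
      finally have "real r * ((1 - \<epsilon>) * m) \<le> real r * real (card (edges G))" using npos by simp
      then show ?thesis using r by simp
    qed
    have finSD: "finite (sym_diff (edges G) (rainbow r V c))" using finE finite_rainbow[OF V(1)] by simp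
    have cB: "real (card (rainbow r V c)) \<ge> m - 2 * \<epsilon> * real n ^ r"
    proof -
      have "edges G \<subseteq> rainbow r V c \<union> sym_diff (edges G) (rainbow r V c)" by blast
      then have "card (edges G) \<le> card (rainbow r V c \<union> sym_diff (edges G) (rainbow r V c))"
        using finSD finite_rainbow[OF V(1)] by (intro card_mono) auto
      also have "\<dots> \<le> card (rainbow r V c) + card (sym_diff (edges G) (rainbow r V c))" by (rule card_Un_le)
      finally have "real (card (edges G)) \<le> real (card (rainbow r V c)) + \<epsilon> * real n ^ r"
        using dist ed by linarith
      moreover have "\<epsilon> * m \<le> \<epsilon> * real n ^ r" using mle \<epsilon>0 by (intro mult_left_mono) auto
      ultimately show ?thesis using cG by (simp add: algebra_simps)
    qed
    have balanced: "\<bar>real (card {x \<in> V. c x = i}) - real n / real t\<bar> \<le> 3 * \<beta> * real n" if "i \<in> {1..t}" for i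
    proof -
      have "\<bar>real (card {x \<in> V. c x = i}) - real n / real t\<bar> \<le> 2 * \<beta> * real n + 1"
        by (rule color_classes_balanced[OF r(1) V npos c m_def[symmetric] mge cB _ \<gamma>0 _ _ that])
          (use \<epsilon> \<beta> in auto)
      moreover have "1 \<le> \<beta> * real n" using large_n[OF \<beta>(1), of 1] n0 by simp
      ultimately show ?thesis by linarith
    qed
    have lower: "g * real n \<le> real (card {x \<in> V. c x = i})" if "i \<in> {1..t}" for i
    proof -
      have "3 * \<beta> \<le> g" using \<beta>(2) t0 by (simp add: g_def field_simps)
      then have "3 * \<beta> * real n \<le> g * real n" by (intro mult_right_mono) auto
      moreover have "real n / real t = 2 * (g * real n)" using t0 by (simp add: g_def)
      ultimately show ?thesis using balanced[OF that] by linarith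
    qed
    have upper: "real (card {x \<in> V. c x = i}) \<le> (1 / real t + 3 * \<beta>) * real n" if "i \<in> {1..t}" for i
      using balanced[OF that] by (simp add: algebra_simps)
    have "edges G \<subseteq> rainbow r V c"
    proof (rule edges_subset_rainbow[OF r H spike G V_def V(2) npos c opt dist[unfolded ed] s_def g0 \<tau>0 \<tau>g lower
          \<delta>1(2)[unfolded h_def] \<delta>2(2)[unfolded h_def] _ _ \<epsilon>(5,6) r\<epsilon> C_def D_def _ _ \<tau>q \<tau>\<delta>])
      show "real r \<le> \<delta>\<^sub>1 * real n" using large_n[OF \<delta>1(1) n0(4)] .
      show "1 \<le> \<delta>\<^sub>2 * real n" using large_n[OF \<delta>2(1) n0(5)] .
      show "(C * q - \<tau>) * real n ^ (r - 1) \<le> real (card (link r G x))" if "x \<in> V" for x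
        using n1[of n] n n0(1) mindeg that unfolding V_def by force
      show "real (card {I \<in> rainbow (r - 1) V c. c ` I = T}) \<le> (q + \<tau>) * real n ^ (r - 1)"
        if "T \<in> nsets {1..t} (r - 1)" for T
        by (rule card_rainbow_type_le[OF V that upper \<beta>(3)])
    qed
    then have "sym_diff (edges G) (rainbow r V c) = rainbow r V c - edges G" by blast
    then have "edit_distance ?\<BB> G = card (rainbow r V c) - card (edges G)"
      using ed \<open>edges G \<subseteq> rainbow r V c\<close> finE by (simp add: card_Diff_subset)
    moreover have "card (edges G) \<le> card (rainbow r V c)"
      using \<open>edges G \<subseteq> rainbow r V c\<close> finite_rainbow[OF V(1)] by (intro card_mono)
    moreover have "card (rainbow r V c) \<le> max_edges ?\<BB> n"
      using card_rainbow_le_max_edges[OF r(1) V(1) c] V(2) by simp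
    ultimately show ?thesis by linarith
  qed
  then show ?thesis
    unfolding vertex_locally_stable_def using \<epsilon>0 by (intro exI[of _ \<epsilon>] exI[of _ 1] exI[of _ n0] conjI) auto
qed

end
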